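(* Let $K$ be a field of characteristic $\ell \geq 0$, and let $\phi \in K(z)$ be bicritical of degree $d \geq 2$ with critical points $\gamma_1, \gamma_2 \in \mathbb{P}^1(\overline{K})$. Assume that $\ell = 0$ or $\ell > d$. Let $K_0=K(\gamma_1,\gamma_2)$, and assume that $\alpha\in K_0$ is not post-critical. For $n\ge1$ let $K_n(\alpha)=K_0(\phi^{-n}(\alpha))$ and $G_n(\alpha)=\mathrm{Gal}(K_n(\alpha)/K_0)$. Let $K_\infty(\alpha)=\bigcup_{n\ge1}K_n(\alpha)$ and $G_\infty(\alpha)=\mathrm{Gal}(K_\infty(\alpha)/K_0)$. Let $\mathbf{U}_d$ denote the group of $d$th roots of unity in $\overline K$. Then $\mathbf{U}_d\subseteq K_1(\alpha)$, $\mathbf{U}_d$ acts by multiplication on $\phi^{-n}(\alpha)$ for each $n\ge1$, and the orbits of this action are the fibers of the projection $\phi^{-n}(\alpha)\to\phi^{-(n-1)}(\alpha)$ given by applying $\phi$. In particular, for each $n\ge2$ the quotient $G_n(\alpha)/G_{n-1}(\alpha)$ embeds into $(C_d)^{d^{n-1}}$. If we further assume that $\mathbf{U}_d\subseteq K_0$, then there is a labeling of $T^d_\infty$ so that $$G_\infty(\alpha)\hookrightarrow [C_d]^\infty\subseteq \mathrm{Aut}(X^* ).$$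
   Context: $\overline{K}$ is a fixed algebraic closure of $K$. Write $\phi = p/q$ with $p,q\in K[z]$ having no common root in $\overline K$. For $\beta\in\overline K$ the ramification index $e_\beta(\phi)$ is the order of vanishing at $z=\beta$ of $p(z)q(\beta)-q(z)p(\beta)$; and $e_\infty(\phi)=e_0(\psi)$ where $\psi(z)=1/\phi(1/z)$. A point $\beta\in\mathbb{P}^1(\overline K)$ is a critical point of $\phi$ if $e_\beta(\phi)>1$. The map $\phi$ is bicritical if it has precisely two (distinct) critical points in $\mathbb{P}^1(\overline K)$. By convention $K(\infty)=K$. $\alpha$ is post-critical if $\alpha=\phi^n(\gamma_i)$ for some $i$ and some $n\ge1$. $\phi^{-n}(\alpha)$ is the set of $\beta\in\mathbb{P}^1(\overline K)$ with $\phi^n(\beta)=\alpha$, with $\phi^{0}$ the identity. $C_d$ is the cyclic group of order $d$. The notation $G_n(\alpha)/G_{n-1}(\alpha)$ means the kernel of the restriction map $G_n(\alpha)\to G_{n-1}(\alpha)$, i.e. $\mathrm{Gal}(K_n(\alpha)/K_{n-1}(\alpha))$. $T^d_\infty=\bigsqcup_{n\ge0}\phi^{-n}(\alpha)$ is a complete infinite $d$-ary rooted tree with root $\alpha$ and edges given by the action of $\phi$; $G_\infty(\alpha)$ acts on it by tree automorphisms. $X^*$ is the abstract complete $d$-ary rooted tree whose vertices are the finite words in $\{0,1,\dots,d-1\}$. A labeling of $T^d_\infty$ is a choice of tree isomorphism $X^*\to T^d_\infty$; it identifies $\mathrm{Aut}(T^d_\infty)$ with $\mathrm{Aut}(X^*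 )$. $[C_d]^\infty$ is the infinite iterated wreath product of $C_d$, viewed as the subgroup of $\mathrm{Aut}(X^* )$ consisting of the automorphisms whose local permutation of $\{0,\dots,d-1\}$ at every vertex is a power of the $d$-cycle $(0\,1\,\cdots\,d-1)$.
   Formalization: "Acts by multiplication" is taken in any coordinate on the projective line, given by a Möbius map over K_0, that sends the critical points to 0 and ∞ (such a map is shown to exist); literal multiplication fails unless they are 0 and ∞, e.g. for z+1/z, α=10/3. *)

theory Defs
  imports
    "HOL-Algebra.Algebraic_Closure_Type"
    "HOL-Algebra.Generated_Fields"
    "HOL-Algebra.Group_Action"
    "HOL-Algebra.Elementary_Groups"
    "HOL-Algebra.Product_Groups"
    "HOL-Combinatorics.Cycles"
begin

section \<open>Rational maps on the projective line\<close>

datatype 'a P1 = Aff 'a | Infty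

text \<open>Throughout, \<open>P\<close> and \<open>Q\<close> are meant to have no common root, so that \<open>P/Q\<close> is in lowest terms.\<close>

definition rat_degree :: "'a::field poly \<Rightarrow> 'a poly \<Rightarrow> nat" where
  "rat_degree P Q = max (Polynomial.degree P) (Polynomial.degree Q)"

fun rat_map :: "'a::field poly \<Rightarrow> 'a poly \<Rightarrow> 'a P1 \<Rightarrow> 'a P1" where
  "rat_map P Q (Aff z) =
     (if poly Q z = 0 then Infty else Aff (poly P z / poly Q z))"
| "rat_map P Q Infty =
     (let D = rat_degree P Q in
      if Polynomial.coeff Q D = 0 then Infty
      else Aff (Polynomial.coeff P D / Polynomial.coeff Q D))"

text \<open>\<open>hrev D P\<close> is \<open>z ^ D * P (1 / z)\<close>, for \<open>D \<ge> degree P\<close>.\<close>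

definition hrev :: "nat \<Rightarrow> 'a::field poly \<Rightarrow> 'a poly" where
  "hrev D P = Polynomial.monom 1 (D - Polynomial.degree P) * reflect_poly P"

definition aff_ram_index :: "'a::field poly \<Rightarrow> 'a poly \<Rightarrow> 'a \<Rightarrow> nat" where
  "aff_ram_index P Q b =
     Polynomial.order b (Polynomial.smult (poly Q b) P - Polynomial.smult (poly P b) Q)"

text \<open>At infinity one uses \<open>1 / \<phi> (1 / z)\<close>, which in lowest terms is \<open>hrev D Q / hrev D P\<close>
  where \<open>D\<close> is the degree of \<open>\<phi> = P / Q\<close>.\<close>

fun ram_index :: "'a::field poly \<Rightarrow> 'a poly \<Rightarrow> 'a P1 \<Rightarrow> nat" where
  "ram_index P Q (Aff b) = aff_ram_index P Q b"
| "ram_index P Q Infty =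
     aff_ram_index (hrev (rat_degree P Q) Q) (hrev (rat_degree P Q) P) 0"

definition critical_points :: "'a::field poly \<Rightarrow> 'a poly \<Rightarrow> 'a P1 set" where
  "critical_points P Q = {\<beta>. ram_index P Q \<beta> > 1}"

text \<open>To be used with \<open>P\<close> and \<open>Q\<close> over an algebraically closed field.\<close>

definition bicritical :: "'a::field poly \<Rightarrow> 'a poly \<Rightarrow> bool" where
  "bicritical P Q \<longleftrightarrow> card (critical_points P Q) = 2"

definition preimages :: "('a P1 \<Rightarrow> 'a P1) \<Rightarrow> nat \<Rightarrow> 'a P1 \<Rightarrow> 'a P1 set" where
  "preimages \<phi> n a = {\<beta>. (\<phi> ^^ n) \<beta> = a}"

definition mobius_maps :: "'a::field set \<Rightarrow> ('a P1 \<Rightarrow> 'a P1) set" where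
  "mobius_maps F = {rat_map [:b, a:] [:d, c:] | a b c d.
     a \<in> F \<and> b \<in> F \<and> c \<in> F \<and> d \<in> F \<and> a * d - b * c \<noteq> 0}"

text \<open>Multiplication by \<open>\<zeta>\<close> in the coordinate \<open>\<mu>\<close> on the projective line; for \<open>\<mu> = id\<close> this is
  ordinary multiplication, fixing \<open>0\<close> and \<open>\<infinity>\<close>.\<close>

definition mult_via :: "('a::field P1 \<Rightarrow> 'a P1) \<Rightarrow> 'a \<Rightarrow> 'a P1 \<Rightarrow> 'a P1" where
  "mult_via \<mu> \<zeta> \<beta> = the_inv \<mu> (map_P1 ((*) \<zeta>) (\<mu> \<beta>))"


section \<open>Fields and Galois groups\<close>

text \<open>\<open>F(S)\<close> for a set \<open>S\<close> of points of the projective line, with the convention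
  \<open>F(\<infinity>) = F\<close>.\<close>

definition adjoin :: "'a::field set \<Rightarrow> 'a P1 set \<Rightarrow> 'a set" where
  "adjoin F S = generate_field ring_of_type_algebra (F \<union> {x. Aff x \<in> S})"

text \<open>The group of field automorphisms of \<open>L\<close> fixing \<open>F\<close> pointwise; the automorphisms are
  extensional functions on \<open>L\<close>.\<close>

definition Gal :: "'a::field set \<Rightarrow> 'a set \<Rightarrow> ('a \<Rightarrow> 'a) monoid" where
  "Gal L F = (BijGroup L)
     \<lparr>carrier := {\<sigma> \<in> Bij L.
        (\<forall>x\<in>L. \<forall>y\<in>L. \<sigma> (x + y) = \<sigma> x + \<sigma> y \<and> \<sigma> (x * y) = \<sigma> x * \<sigma> y) \<and>
        (\<forall>x\<in>F. \<sigma> x = x)}\<rparr>"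

definition restriction_kernel :: "'a::field set \<Rightarrow> 'a set \<Rightarrow> 'a set \<Rightarrow> ('a \<Rightarrow> 'a) monoid" where
  "restriction_kernel L M F =
     (Gal L F)\<lparr>carrier := kernel (Gal L F) (Gal M F) (\<lambda>\<sigma>. restrict \<sigma> M)\<rparr>"

definition roots_of_unity_group :: "nat \<Rightarrow> 'a::field monoid" where
  "roots_of_unity_group d = \<lparr>carrier = {\<zeta>. \<zeta> ^ d = 1}, monoid.mult = (*), one = 1\<rparr>"


section \<open>Rooted trees and their automorphisms\<close>

definition rooted_tree_iso ::
  "'v set \<Rightarrow> ('v \<times> 'v) set \<Rightarrow> 'v \<Rightarrow> 'w set \<Rightarrow> ('w \<times> 'w) set \<Rightarrow> 'w \<Rightarrow> ('v \<Rightarrow> 'w) \<Rightarrow> bool" where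
  "rooted_tree_iso V E r V' E' r' f \<longleftrightarrow>
     bij_betw f V V' \<and> f r = r' \<and>
     (\<forall>u\<in>V. \<forall>v\<in>V. (u, v) \<in> E \<longleftrightarrow> (f u, f v) \<in> E')"

text \<open>The tree of words over \<open>{0,\<dots>,d-1}\<close>; the children of \<open>w\<close> are the words \<open>w @ [x]\<close>, and
  edges point away from the root.\<close>

definition word_verts :: "nat \<Rightarrow> nat list set" where
  "word_verts d = lists {..<d}"

definition word_edges :: "nat \<Rightarrow> (nat list \<times> nat list) set" where
  "word_edges d = {(w, w @ [x]) | w x. w \<in> word_verts d \<and> x < d}"

definition word_tree_aut :: "nat \<Rightarrow> (nat list \<Rightarrow> nat list) monoid" where
  "word_tree_aut d = (BijGroup (word_verts d))
     \<lparr>carrier := {g \<in> Bij (word_verts d).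
        rooted_tree_iso (word_verts d) (word_edges d) [] (word_verts d) (word_edges d) [] g}\<rparr>"

text \<open>For a tree automorphism \<open>g\<close> one has \<open>g (w @ [x]) = g w @ [local_perm g w x]\<close>.\<close>

definition local_perm :: "(nat list \<Rightarrow> nat list) \<Rightarrow> nat list \<Rightarrow> nat \<Rightarrow> nat" where
  "local_perm g w x = last (g (w @ [x]))"

definition wreath_cyclic :: "nat \<Rightarrow> (nat list \<Rightarrow> nat list) monoid" where
  "wreath_cyclic d = (word_tree_aut d)
     \<lparr>carrier := {g \<in> carrier (word_tree_aut d).
        \<forall>w\<in>word_verts d. \<exists>k. \<forall>x<d. local_perm g w x = (cycle_of_list [0..<d] ^^ k) x}\<rparr>"

text \<open>The preimage tree is a disjoint union over the levels, since the same point may occur on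
  several levels.\<close>

definition preim_verts :: "('a P1 \<Rightarrow> 'a P1) \<Rightarrow> 'a P1 \<Rightarrow> (nat \<times> 'a P1) set" where
  "preim_verts \<phi> a = Sigma UNIV (\<lambda>n. preimages \<phi> n a)"

definition preim_edges :: "('a P1 \<Rightarrow> 'a P1) \<Rightarrow> 'a P1 \<Rightarrow> ((nat \<times> 'a P1) \<times> (nat \<times> 'a P1)) set" where
  "preim_edges \<phi> a = {((n, \<phi> \<beta>), (Suc n, \<beta>)) | n \<beta>. \<beta> \<in> preimages \<phi> (Suc n) a}"

definition labeling ::
  "nat \<Rightarrow> ('a P1 \<Rightarrow> 'a P1) \<Rightarrow> 'a P1 \<Rightarrow> (nat list \<Rightarrow> nat \<times> 'a P1) \<Rightarrow> bool" where
  "labeling d \<phi> a \<Lambda> \<longleftrightarrow>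
     rooted_tree_iso (word_verts d) (word_edges d) []
       (preim_verts \<phi> a) (preim_edges \<phi> a) (0, a) \<Lambda>"

text \<open>The action of \<open>\<sigma>\<close> on the words that corresponds, under the labeling \<open>\<Lambda>\<close>, to its action on
  the preimage tree.\<close>

definition labeled_action ::
  "nat \<Rightarrow> (nat list \<Rightarrow> nat \<times> 'a P1) \<Rightarrow> ('a \<Rightarrow> 'a) \<Rightarrow> nat list \<Rightarrow> nat list" where
  "labeled_action d \<Lambda> \<sigma> =
     (\<lambda>w\<in>word_verts d. the_inv_into (word_verts d) \<Lambda> (map_prod id (map_P1 \<sigma>) (\<Lambda> w)))"

end

theory Submission
  imports Defs
begin

text \<open>
  The theorem rests on one normal form: in a coordinate \<open>\<mu>\<close> that puts the two critical points at
  \<open>0\<close> and \<open>\<infinity>\<close>, the map \<open>\<phi>\<close> is the power map \<open>z \<mapsto> z ^ d\<close> followed by a Moebius map \<open>\<nu>\<close>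
  of the target. To see this, count critical points with the Wronskian \<open>W = P' Q - P Q'\<close> of
  \<open>\<phi> = P / Q\<close>. Since the characteristic is \<open>0\<close> or exceeds \<open>d\<close>, the ramification index at an affine
  point is one more than the order of \<open>W\<close> there, and \<open>deg W = 2 d - 1 - e\<^sub>\<infinity>\<close>; hence the numbers
  \<open>e - 1\<close> add up to \<open>2 d - 2\<close> over the projective line. Each is at most \<open>d - 1\<close>, so two critical
  points can only exhaust the total if both are totally ramified (\<open>totally_ramified\<close>). Total
  ramification at \<open>\<gamma>\<close> says that the pencil spanned by \<open>P\<close> and \<open>Q\<close> contains the \<open>d\<close>-th power of the
  linear form vanishing at \<open>\<gamma>\<close>. The two powers so obtained are independent, and the coefficients
  that express them by \<open>P\<close> and \<open>Q\<close> make up \<open>\<nu>\<close> (\<open>power_map_normal_form\<close>).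

  Consequently two points lie in the same fiber of \<open>\<phi>\<close> exactly if a \<open>d\<close>-th root of unity carries
  one to the other by multiplication in the coordinate \<open>\<mu>\<close>. As \<open>\<alpha>\<close> is not post-critical, no point
  of the preimage tree above the root has \<open>\<mu>\<close>-coordinate \<open>0\<close> or \<open>\<infinity>\<close>, so this action is free on
  every level \<open>n \<ge> 1\<close>: every fiber in the tree is a principal homogeneous space of the group of
  \<open>d\<close>-th roots of unity, which is cyclic of order \<open>d\<close>. Ratios of coordinates in a single fiber give all roots of
  unity, so these lie in \<open>K\<^sub>1\<close>.

  The maps \<open>\<phi>\<close> and \<open>\<mu>\<close> are defined over the base field, so they commute with Galois
  automorphisms. An automorphism that fixes the roots of unity therefore commutes with their action
  and moves a fiber to a fiber by a translation. For an automorphism of \<open>K\<^sub>n\<close> over \<open>K\<^sub>n\<^sub>-\<^sub>1\<close> the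
  fibers above level \<open>n - 1\<close> are preserved, and its \<open>d ^ (n - 1)\<close> translation amounts determine it
  (\<open>restriction_kernel_embeds\<close>). If the roots of unity are in the base field, choose a base point in
  every fiber and label the children of a node by the power of a fixed primitive root of unity that
  leads from the base point to them; translations then become powers of the standard \<open>d\<close>-cycle
  (\<open>labeled_action_mon\<close>).
\<close>

section \<open>Homogeneous coordinates on the projective line\<close>

fun hom_x :: "'a::field P1 \<Rightarrow> 'a" where
  "hom_x (Aff z) = z" | "hom_x Infty = 1"

fun hom_y :: "'a::field P1 \<Rightarrow> 'a" where
  "hom_y (Aff z) = 1" | "hom_y Infty = 0"

definition of_hom :: "'a::field \<Rightarrow> 'a \<Rightarrow> 'a P1" where
  "of_hom x y = (if y = 0 then Infty else Aff (x / y))"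

text \<open>The value at a point of the binary form of degree \<open>D\<close> whose dehomogenization is the given
  polynomial, on the representatives \<open>(z, 1)\<close> and \<open>(1, 0)\<close>. It makes \<open>\<infinity>\<close> a point like any other.\<close>

fun heval :: "nat \<Rightarrow> 'a::field poly \<Rightarrow> 'a P1 \<Rightarrow> 'a" where
  "heval D P (Aff z) = poly P z" | "heval D P Infty = Polynomial.coeff P D"

lemma hom_coords_nonzero: "hom_x p \<noteq> 0 \<or> hom_y p \<noteq> 0"
  by (cases p) auto

lemma of_hom_eq_iff:
  assumes "x \<noteq> 0 \<or> y \<noteq> 0" "x' \<noteq> 0 \<or> y' \<noteq> 0"
  shows "of_hom x y = of_hom x' y' \<longleftrightarrow> x * y' = x' * y"
  using assms by (auto simp: of_hom_def field_simps)

lemma of_hom_hom [simp]: "of_hom (hom_x p) (hom_y p) = p"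
  by (cases p) (auto simp: of_hom_def)

lemma of_hom_eq_0_iff: "of_hom x y = Aff 0 \<longleftrightarrow> x = 0 \<and> y \<noteq> 0"
  by (auto simp: of_hom_def)

lemma of_hom_eq_Infty_iff: "of_hom x y = Infty \<longleftrightarrow> y = 0"
  by (auto simp: of_hom_def)

lemma hom_of_hom:
  assumes "x \<noteq> 0 \<or> y \<noteq> 0"
  obtains k where "k \<noteq> 0" "x = k * hom_x (of_hom x y)" "y = k * hom_y (of_hom x y)"
proof (cases "y = 0")
  case True
  then show ?thesis using assms that[of x] by (auto simp: of_hom_def)
next
  case False
  then show ?thesis using that[of y] by (auto simp: of_hom_def)
qed

lemma of_hom_scale: "k \<noteq> 0 \<Longrightarrow> of_hom (k * x) (k * y) = of_hom x y"
  by (auto simp: of_hom_def)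

lemma rat_map_eq_of_hom:
  "rat_map P Q x = of_hom (heval (rat_degree P Q) P x) (heval (rat_degree P Q) Q x)"
  by (cases x) (auto simp: of_hom_def Let_def)

lemma heval_combination:
  "heval D (smult a P + smult b Q) x = a * heval D P x + b * heval D Q x"
  by (cases x) auto

lemma heval_linear: "heval 1 [:b, a:] x = a * hom_x x + b * hom_y x"
  by (cases x) auto

lemma coeff_mult_degree_le:
  fixes p q :: "'a::comm_semiring_0 poly"
  assumes "Polynomial.degree p \<le> m" "Polynomial.degree q \<le> n"
  shows "Polynomial.coeff (p * q) (m + n) = Polynomial.coeff p m * Polynomial.coeff q n"
proof -
  have "Polynomial.coeff (p * q) (m + n)
      = (\<Sum>i\<le>m + n. Polynomial.coeff p i * Polynomial.coeff q (m + n - i))"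
    by (simp add: coeff_mult)
  also have "\<dots> = (\<Sum>i\<in>{m}. Polynomial.coeff p i * Polynomial.coeff q (m + n - i))"
  proof (intro sum.mono_neutral_right ballI)
    fix i assume "i \<in> {..m + n} - {m}"
    then consider "i > m" | "i < m" by fastforce
    then show "Polynomial.coeff p i * Polynomial.coeff q (m + n - i) = 0"
      using assms by cases (auto simp: coeff_eq_0)
  qed auto
  finally show ?thesis by simp
qed

lemma heval_power:
  fixes P :: "'a::field poly"
  assumes "Polynomial.degree P \<le> 1"
  shows "heval n (P ^ n) x = heval 1 P x ^ n"
proof (cases x)
  case Infty
  have "Polynomial.coeff (P ^ n) n = Polynomial.coeff P 1 ^ n"
  proof (induction n)
    case (Suc n)
    have "Polynomial.degree (P ^ n) \<le> n"
      using le_trans[OF degree_power_le mult_le_mono1[OF assms, of n]] by simp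
    from coeff_mult_degree_le[OF assms this] show ?case by (simp add: Suc)
  qed simp
  with Infty show ?thesis by simp
qed simp

subsection \<open>Moebius maps\<close>

lemma mobius_eq_of_hom:
  fixes a b c d :: "'a::field"
  assumes "a * d - b * c \<noteq> 0"
  shows "rat_map [:b, a:] [:d, c:] x =
    of_hom (a * hom_x x + b * hom_y x) (c * hom_x x + d * hom_y x)"
proof -
  have "rat_degree [:b, a:] [:d, c:] = 1"
    using assms by (auto simp: rat_degree_def)
  then show ?thesis by (simp only: rat_map_eq_of_hom heval_linear)
qed

text \<open>By Cramer's rule an invertible matrix has trivial kernel.\<close>

lemma linear_map_nonzero:
  fixes a b c d :: "'a::field"
  assumes "a * d - b * c \<noteq> 0" "x \<noteq> 0 \<or> y \<noteq> 0"
  shows "a * x + b * y \<noteq> 0 \<or> c * x + d * y \<noteq> 0"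
proof (rule ccontr)
  assume "\<not> ?thesis"
  then have *: "a * x + b * y = 0" "c * x + d * y = 0" by auto
  have "(a * d - b * c) * x = d * (a * x + b * y) - b * (c * x + d * y)"
    "(a * d - b * c) * y = a * (c * x + d * y) - c * (a * x + b * y)"
    by (simp_all add: algebra_simps)
  with * assms show False by auto
qed

text \<open>Injectivity is multiplicativity of the determinant; a preimage is given by the adjugate matrix.\<close>

lemma bij_mobius:
  fixes a b c d :: "'a::field"
  assumes det: "a * d - b * c \<noteq> 0"
  shows "bij (rat_map [:b, a:] [:d, c:])" (is "bij ?\<mu>")
proof (rule bijI)
  show "inj ?\<mu>"
  proof (rule injI)
    fix x y assume "?\<mu> x = ?\<mu> y"
    then have "(a * hom_x x + b * hom_y x) * (c * hom_x y + d * hom_y y) =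
        (a * hom_x y + b * hom_y y) * (c * hom_x x + d * hom_y x)"
      unfolding mobius_eq_of_hom[OF det]
        of_hom_eq_iff[OF linear_map_nonzero[OF det hom_coords_nonzero]
          linear_map_nonzero[OF det hom_coords_nonzero]] .
    then have "(a * d - b * c) * (hom_x x * hom_y y - hom_x y * hom_y x) = 0"
      by (simp add: algebra_simps)
    then have "hom_x x * hom_y y = hom_x y * hom_y x" using det by simp
    then have "of_hom (hom_x x) (hom_y x) = of_hom (hom_x y) (hom_y y)"
      unfolding of_hom_eq_iff[OF hom_coords_nonzero hom_coords_nonzero] .
    then show "x = y" by simp
  qed
  show "surj ?\<mu>"
  proof (rule surjI)
    fix y :: "'a P1"
    let ?u = "d * hom_x y + (- b) * hom_y y" and ?v = "(- c) * hom_x y + a * hom_y y"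
    have "?u \<noteq> 0 \<or> ?v \<noteq> 0"
      by (rule linear_map_nonzero[OF _ hom_coords_nonzero]) (use det in \<open>simp add: algebra_simps\<close>)
    then obtain k where k: "k \<noteq> 0" "?u = k * hom_x (of_hom ?u ?v)" "?v = k * hom_y (of_hom ?u ?v)"
      by (rule hom_of_hom)
    define x where "x = of_hom ?u ?v"
    have "?\<mu> x = of_hom (k * (a * hom_x x + b * hom_y x)) (k * (c * hom_x x + d * hom_y x))"
      by (simp only: mobius_eq_of_hom[OF det] of_hom_scale[OF k(1)])
    also have "\<dots> = of_hom (a * (k * hom_x x) + b * (k * hom_y x)) (c * (k * hom_x x) + d * (k * hom_y x))"
      by (simp add: algebra_simps)
    also have "\<dots> = of_hom (a * ?u + b * ?v) (c * ?u + d * ?v)"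
      unfolding x_def k(2)[symmetric] k(3)[symmetric] ..
    also have "\<dots> = of_hom ((a * d - b * c) * hom_x y) ((a * d - b * c) * hom_y y)"
      by (simp add: algebra_simps)
    also have "\<dots> = y" by (simp only: of_hom_scale[OF det] of_hom_hom)
    finally show "?\<mu> (of_hom ?u ?v) = y" by (simp add: x_def)
  qed
qed

lemma map_power_of_hom:
  assumes "n > 0"
  shows "map_P1 (\<lambda>z. z ^ n) (of_hom x y) = of_hom (x ^ n) (y ^ n)"
  using assms by (auto simp: of_hom_def power_divide)

section \<open>Counting critical points with the Wronskian\<close>

definition wronskian :: "'a::field poly \<Rightarrow> 'a poly \<Rightarrow> 'a poly" where
  "wronskian P Q = pderiv P * Q - P * pderiv Q"

text \<open>The Wronskian is bilinear and alternating. So \<open>P\<close> or \<open>Q\<close> may be traded for any other member of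
  their pencil, in particular for one that vanishes to high order at a given point.\<close>

lemma wronskian_combination:
  "wronskian (smult a P + smult b Q) Q = smult a (wronskian P Q)"
  "wronskian (smult a P + smult b Q) P = smult (- b) (wronskian P Q)"
  by (simp_all add: wronskian_def pderiv_add pderiv_smult algebra_simps smult_diff_right)

text \<open>If \<open>R = (z - b) ^ (e + 1) * S\<close>, then \<open>R'\<close> has the term \<open>(e + 1) (z - b) ^ e * S\<close>, and every other
  term of the Wronskian vanishes to order at least \<open>e + 1\<close>. This needs \<open>e + 1\<close> to be nonzero in the
  field.\<close>

lemma order_wronskian:
  fixes R T :: "'a::field poly"
  assumes "R \<noteq> 0" "poly T b \<noteq> 0" "Polynomial.order b R = Suc e" "of_nat (Suc e) \<noteq> (0::'a)"
  shows "wronskian R T \<noteq> 0 \<and> Polynomial.order b (wronskian R T) = e"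
proof -
  let ?l = "[:-b, 1:]"
  obtain S where S: "R = ?l ^ Suc e * S" "\<not> ?l dvd S"
    using order_decomp[OF assms(1), of b] assms(3) by auto
  then have Sb: "poly S b \<noteq> 0" by (simp add: poly_eq_0_iff_dvd)
  have pd: "pderiv R = ?l ^ e * (?l * pderiv S + smult (of_nat (Suc e)) S)"
    unfolding S(1) lemma_order_pderiv1 by (simp add: algebra_simps)
  define U where "U = (?l * pderiv S + smult (of_nat (Suc e)) S) * T - ?l * S * pderiv T"
  have W: "wronskian R T = ?l ^ e * U"
    unfolding wronskian_def pd unfolding S(1) U_def by (simp add: algebra_simps)
  have "poly U b = of_nat (Suc e) * poly S b * poly T b"
    by (simp add: U_def del: of_nat_Suc)
  then have Ub: "poly U b \<noteq> 0" using Sb assms(2,4) by simp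
  then have "U \<noteq> 0" by auto
  then have nz: "wronskian R T \<noteq> 0" by (simp add: W)
  moreover have "Polynomial.order b (wronskian R T) = e"
    using nz Ub unfolding W by (subst order_mult) (auto simp: order_power_n_n order_0I)
  ultimately show ?thesis by simp
qed

text \<open>The coefficients of \<open>R' T\<close> and \<open>R T'\<close> in degree \<open>deg R + deg T - 1\<close> differ by
  \<open>deg T - deg R\<close> times the product of the leading coefficients.\<close>

lemma degree_wronskian:
  fixes R T :: "'a::field poly"
  assumes "R \<noteq> 0" "Polynomial.degree R < Polynomial.degree T"
    and "of_nat (Polynomial.degree T - Polynomial.degree R) \<noteq> (0::'a)"
  shows "Suc (Polynomial.degree (wronskian R T)) = Polynomial.degree R + Polynomial.degree T"
proof -
  define m n where "m = Polynomial.degree R" and "n = Polynomial.degree T"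
  obtain k where k: "n = Suc k" using assms(2) by (cases n) (auto simp: n_def)
  have dT: "Polynomial.degree (pderiv T) \<le> k"
    by (rule degree_le) (use k n_def in \<open>simp add: coeff_pderiv coeff_eq_0\<close>)
  have dR: "Polynomial.degree (pderiv R) \<le> m - 1"
    by (rule degree_le) (use m_def in \<open>simp add: coeff_pderiv coeff_eq_0\<close>)
  have c1: "Polynomial.coeff (R * pderiv T) (m + k) = of_nat n * (Polynomial.lead_coeff R * Polynomial.lead_coeff T)"
    by (subst coeff_mult_degree_le)
      (use dT k in \<open>simp_all add: m_def n_def coeff_pderiv del: of_nat_Suc\<close>)
  have c2: "Polynomial.coeff (pderiv R * T) (m + k) = of_nat m * (Polynomial.lead_coeff R * Polynomial.lead_coeff T)"
    and d2: "Polynomial.degree (pderiv R * T) \<le> m + k"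
  proof -
    show "Polynomial.coeff (pderiv R * T) (m + k) = of_nat m * (Polynomial.lead_coeff R * Polynomial.lead_coeff T)"
    proof (cases m)
      case 0
      then have "pderiv R = 0" by (auto simp: m_def pderiv_pCons elim: degree_eq_zeroE)
      with 0 show ?thesis by simp
    next
      case (Suc j)
      have "Polynomial.coeff (pderiv R * T) (j + n) = Polynomial.coeff (pderiv R) j * Polynomial.coeff T n"
        by (rule coeff_mult_degree_le) (use dR Suc n_def in auto)
      moreover have "j + n = m + k" using Suc k by simp
      ultimately show ?thesis
        using Suc by (simp add: coeff_pderiv m_def n_def del: of_nat_Suc)
    qed
    show "Polynomial.degree (pderiv R * T) \<le> m + k"
    proof (cases m)
      case 0
      then have "pderiv R = 0" by (auto simp: m_def pderiv_pCons elim: degree_eq_zeroE)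
      then show ?thesis by simp
    next
      case (Suc j)
      then show ?thesis using degree_mult_le[of "pderiv R" T] dR k n_def by linarith
    qed
  qed
  have "Polynomial.degree (R * pderiv T) \<le> m + k"
    using degree_mult_le[of R "pderiv T"] dT m_def by linarith
  with d2 have le: "Polynomial.degree (wronskian R T) \<le> m + k"
    unfolding wronskian_def by (rule degree_diff_le)
  have "Polynomial.coeff (wronskian R T) (m + k)
      = - of_nat (n - m) * (Polynomial.lead_coeff R * Polynomial.lead_coeff T)"
    using assms(2) unfolding wronskian_def coeff_diff c1 c2
    by (simp add: m_def n_def algebra_simps)
  also have "\<dots> \<noteq> 0"
    using assms by (auto simp: m_def n_def)
  finally have "m + k \<le> Polynomial.degree (wronskian R T)" by (rule le_degree)
  with le k show ?thesis by (simp add: m_def n_def)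
qed

lemma degree_le_sum_orders:
  fixes p :: "'a::alg_closed_field poly"
  assumes "p \<noteq> 0" "finite S" "\<And>x. poly p x = 0 \<Longrightarrow> x \<in> S"
  shows "Polynomial.degree p \<le> (\<Sum>x\<in>S. Polynomial.order x p)"
  using assms(1,3)
proof (induction p rule: poly_root_order_induct)
  case (no_roots p)
  then have "Polynomial.degree p = 0" using alg_closed_imp_poly_has_root[of p] by blast
  then show ?case by simp
next
  case (root p x n)
  let ?l = "[:-x, 1:]"
  from root.prems have p0: "p \<noteq> 0" and "x \<in> S"
    using root.hyps by auto
  have "Polynomial.degree (?l ^ n * p) = n + Polynomial.degree p"
    using p0 by (simp add: degree_mult_eq degree_power_eq)
  also have "\<dots> \<le> n + (\<Sum>y\<in>S. Polynomial.order y p)"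
    using root.IH[OF p0] root.prems(2) by simp
  also have "n \<le> (\<Sum>y\<in>S. Polynomial.order y (?l ^ n))"
    using member_le_sum[OF \<open>x \<in> S\<close> _ assms(2), of "\<lambda>y. Polynomial.order y (?l ^ n)"]
    by (simp add: order_power_n_n)
  also have "(\<Sum>y\<in>S. Polynomial.order y (?l ^ n)) + (\<Sum>y\<in>S. Polynomial.order y p)
      = (\<Sum>y\<in>S. Polynomial.order y (?l ^ n * p))"
    unfolding sum.distrib[symmetric]
    by (intro sum.cong refl order_mult[symmetric]) (use p0 in auto)
  finally show ?case by simp
qed simp

lemma coeff_hrev:
  assumes "Polynomial.degree P \<le> D"
  shows "Polynomial.coeff (hrev D P) i = (if i \<le> D then Polynomial.coeff P (D - i) else 0)"
proof -
  consider "i < D - Polynomial.degree P" | "D - Polynomial.degree P \<le> i" "i \<le> D" | "i > D"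
    by linarith
  then show ?thesis
  proof cases
    case 1
    then show ?thesis by (simp add: hrev_def coeff_monom_mult coeff_eq_0)
  next
    case 2
    then have "i - (D - Polynomial.degree P) \<le> Polynomial.degree P"
      "Polynomial.degree P - (i - (D - Polynomial.degree P)) = D - i" using assms by auto
    with 2 show ?thesis by (simp add: hrev_def coeff_monom_mult coeff_reflect_poly)
  next
    case 3
    then have "i - (D - Polynomial.degree P) > Polynomial.degree P" using assms by auto
    with 3 show ?thesis by (simp add: hrev_def coeff_monom_mult coeff_reflect_poly)
  qed
qed

lemma order_0_hrev:
  assumes "P \<noteq> 0"
  shows "Polynomial.order 0 (hrev D P) = D - Polynomial.degree P"
proof -
  have "poly (reflect_poly P) 0 \<noteq> 0" using assms by (simp add: poly_0_coeff_0)
  moreover from this have "Polynomial.monom 1 (D - Polynomial.degree P) * reflect_poly P \<noteq> 0" by auto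
  ultimately show ?thesis
    unfolding hrev_def by (subst order_mult) (auto intro: order_0I)
qed

locale bicritical_rational_map =
  fixes P Q :: "'a::alg_closed_field poly" and d :: nat and \<gamma>1 \<gamma>2 :: "'a P1"
  assumes no_common_root: "\<nexists>x. poly P x = 0 \<and> poly Q x = 0"
    and degree_eq: "rat_degree P Q = d"
    and d_ge_2: "d \<ge> 2"
    and critical_points_eq: "critical_points P Q = {\<gamma>1, \<gamma>2}"
    and distinct_critical: "\<gamma>1 \<noteq> \<gamma>2"
    and of_nat_nonzero: "\<And>n. 0 < n \<Longrightarrow> n \<le> d \<Longrightarrow> of_nat n \<noteq> (0::'a)"
begin

lemma degree_le: "Polynomial.degree P \<le> d" "Polynomial.degree Q \<le> d"
  using degree_eq by (auto simp: rat_degree_def)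

text \<open>A proportionality would turn any root of one polynomial into a common root; then both would be
  constant.\<close>

lemma linearly_independent:
  assumes "smult a P + smult b Q = 0"
  shows "a = 0" "b = 0"
proof -
  have "Polynomial.degree p = 0 \<and> Polynomial.degree q = 0"
    if eq: "smult u p + smult v q = 0" and "u \<noteq> 0"
      and ncr: "\<nexists>x. poly p x = 0 \<and> poly q x = 0" for u v and p q :: "'a poly"
  proof -
    have p: "smult u p = smult (- v) q" using eq by (simp add: eq_neg_iff_add_eq_0)
    have "poly q x \<noteq> 0" for x
    proof
      assume "poly q x = 0"
      with arg_cong[OF p, of "\<lambda>f. poly f x"] \<open>u \<noteq> 0\<close> have "poly p x = 0" by simp
      with \<open>poly q x = 0\<close> ncr show False by blast
    qed
    then have q: "Polynomial.degree q = 0" using alg_closed_imp_poly_has_root[of q] by blast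
    have "Polynomial.degree p = Polynomial.degree (smult u p)" using \<open>u \<noteq> 0\<close> by simp
    also have "\<dots> \<le> Polynomial.degree q" unfolding p by simp
    finally show ?thesis using q by simp
  qed note * = this
  show "a = 0"
    using *[OF assms _ no_common_root] degree_eq d_ge_2 by (fastforce simp: rat_degree_def)
  show "b = 0"
    using *[of b Q a P] assms no_common_root degree_eq d_ge_2
    by (fastforce simp: rat_degree_def add.commute)
qed

lemma heval_nonzero: "heval d P x \<noteq> 0 \<or> heval d Q x \<noteq> 0"
proof (cases x)
  case Infty
  have "Polynomial.degree P = d \<and> P \<noteq> 0 \<or> Polynomial.degree Q = d \<and> Q \<noteq> 0"
    using degree_eq d_ge_2 by (auto simp: rat_degree_def max_def split: if_splits)
  with Infty show ?thesis by auto
qed (use no_common_root in auto)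

text \<open>Up to a factor the only member of the pencil of \<open>P\<close> and \<open>Q\<close> that vanishes at \<open>x\<close>, that is, the form cutting
  out the fiber of \<open>\<phi>\<close> through \<open>x\<close>; its order of vanishing at \<open>x\<close> is the ramification
  index.\<close>

definition pencil_at :: "'a P1 \<Rightarrow> 'a poly" where
  "pencil_at x = smult (heval d Q x) P + smult (- heval d P x) Q"

lemma pencil_at_nonzero: "pencil_at x \<noteq> 0"
  using linearly_independent heval_nonzero unfolding pencil_at_def by fastforce

lemma degree_pencil_at: "Polynomial.degree (pencil_at x) \<le> d"
  unfolding pencil_at_def
  by (intro degree_add_le order_trans[OF degree_smult_le] degree_le)

lemma ram_index_Aff: "ram_index P Q (Aff b) = Polynomial.order b (pencil_at (Aff b))"
  by (simp add: aff_ram_index_def pencil_at_def)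

text \<open>The coefficient reversal turns the order of vanishing at infinity of a form of degree \<open>d\<close> into the
  defect \<open>d - deg\<close> of its degree.\<close>

lemma ram_index_Infty: "ram_index P Q Infty = d - Polynomial.degree (pencil_at Infty)"
proof -
  have *: "poly (hrev d p) 0 = Polynomial.coeff p d" if "Polynomial.degree p \<le> d" for p
    using coeff_hrev[OF that, of 0] by (simp add: poly_0_coeff_0)
  have "smult (Polynomial.coeff P d) (hrev d Q) - smult (Polynomial.coeff Q d) (hrev d P)
      = - hrev d (pencil_at Infty)"
    by (rule poly_eqI)
      (simp add: coeff_hrev degree_le degree_pencil_at, simp add: pencil_at_def)
  then show ?thesis
    by (simp add: aff_ram_index_def degree_eq * degree_le order_0_hrev pencil_at_nonzero)
qed

lemma degree_pencil_at_Infty: "Polynomial.degree (pencil_at Infty) < d"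
proof -
  have "Polynomial.coeff (pencil_at Infty) d = 0" by (simp add: pencil_at_def)
  then show ?thesis
    using degree_pencil_at[of Infty] pencil_at_nonzero[of Infty] leading_coeff_0_iff
      le_neq_implies_less by metis
qed

lemma ram_index_bounds: "1 \<le> ram_index P Q x \<and> ram_index P Q x \<le> d"
proof (cases x)
  case (Aff b)
  have "poly (pencil_at (Aff b)) b = 0" by (simp add: pencil_at_def)
  then have "Polynomial.order b (pencil_at (Aff b)) \<noteq> 0"
    using pencil_at_nonzero by (simp add: order_root)
  moreover have "Polynomial.order b (pencil_at (Aff b)) \<le> d"
    using order_degree[OF pencil_at_nonzero] degree_pencil_at order_trans by blast
  ultimately show ?thesis unfolding Aff ram_index_Aff by simp
next
  case Infty
  then show ?thesis unfolding Infty ram_index_Infty using degree_pencil_at_Infty by simp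
qed

lemma wronskian_pencil_at:
  "wronskian (pencil_at x) Q = smult (heval d Q x) (wronskian P Q)"
  "wronskian (pencil_at x) P = smult (heval d P x) (wronskian P Q)"
  unfolding pencil_at_def wronskian_combination by simp_all

lemma wronskian_nonzero: "wronskian P Q \<noteq> 0"
  and order_wronskian_eq: "Suc (Polynomial.order b (wronskian P Q)) = ram_index P Q (Aff b)"
proof -
  have *: "wronskian P Q \<noteq> 0 \<and> Suc (Polynomial.order b (wronskian P Q)) = ram_index P Q (Aff b)" for b
  proof -
    obtain e where e: "Polynomial.order b (pencil_at (Aff b)) = Suc e" "Suc e \<le> d"
      using ram_index_bounds[of "Aff b"] unfolding ram_index_Aff
      by (cases "Polynomial.order b (pencil_at (Aff b))") auto
    have nz: "of_nat (Suc e) \<noteq> (0::'a)" using of_nat_nonzero e by blast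
    consider "poly Q b \<noteq> 0" | "poly P b \<noteq> 0" using no_common_root by blast
    then show ?thesis
    proof cases
      case 1
      with order_wronskian[OF pencil_at_nonzero 1 e(1) nz]
      show ?thesis unfolding ram_index_Aff wronskian_pencil_at by (auto simp: order_smult e)
    next
      case 2
      with order_wronskian[OF pencil_at_nonzero 2 e(1) nz]
      show ?thesis unfolding ram_index_Aff wronskian_pencil_at by (auto simp: order_smult e)
    qed
  qed
  show "wronskian P Q \<noteq> 0" "Suc (Polynomial.order b (wronskian P Q)) = ram_index P Q (Aff b)"
    using * by blast+
qed

text \<open>Together with the orders at affine points this is the Riemann-Hurwitz formula for \<open>P / Q\<close>.\<close>

lemma degree_wronskian_eq:
  "Polynomial.degree (wronskian P Q) + 1 + ram_index P Q Infty = 2 * d"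
proof -
  have *: "of_nat (d - Polynomial.degree (pencil_at Infty)) \<noteq> (0::'a)"
    using degree_pencil_at_Infty by (intro of_nat_nonzero) auto
  consider "Polynomial.coeff Q d \<noteq> 0" | "Polynomial.coeff P d \<noteq> 0" using heval_nonzero[of Infty] by auto
  then have "Suc (Polynomial.degree (wronskian P Q)) = Polynomial.degree (pencil_at Infty) + d"
  proof cases
    case 1
    then have d: "Polynomial.degree Q = d" using degree_le(2) le_degree le_antisym by metis
    from degree_wronskian[OF pencil_at_nonzero, of Infty Q] 1 * show ?thesis
      by (simp add: d degree_pencil_at_Infty wronskian_pencil_at)
  next
    case 2
    then have d: "Polynomial.degree P = d" using degree_le(1) le_degree le_antisym by metis
    from degree_wronskian[OF pencil_at_nonzero, of Infty P] 2 * show ?thesis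
      by (simp add: d degree_pencil_at_Infty wronskian_pencil_at)
  qed
  then show ?thesis using degree_pencil_at_Infty unfolding ram_index_Infty by linarith
qed

lemma ram_index_critical: "ram_index P Q x > 1 \<longleftrightarrow> x \<in> {\<gamma>1, \<gamma>2}"
  using critical_points_eq by (auto simp: critical_points_def)

text \<open>The two numbers \<open>e - 1 \<le> d - 1\<close> have to add up to at least \<open>2 d - 2\<close>.\<close>

lemma totally_ramified: "ram_index P Q \<gamma>1 = d \<and> ram_index P Q \<gamma>2 = d"
proof -
  let ?W = "wronskian P Q" and ?S = "{x. Aff x \<in> {\<gamma>1, \<gamma>2}}"
  have S: "?S = Aff -` {\<gamma>1, \<gamma>2}" by auto
  have fin: "finite ?S" unfolding S by (intro finite_vimageI) (auto intro: injI)
  have roots: "x \<in> ?S" if "poly ?W x = 0" for x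
  proof -
    have "Polynomial.order x ?W \<noteq> 0" using that wronskian_nonzero by (simp add: order_root)
    then have "ram_index P Q (Aff x) > 1" using order_wronskian_eq[of x] by linarith
    then show ?thesis using ram_index_critical by blast
  qed
  have order_W: "Polynomial.order x ?W = ram_index P Q (Aff x) - 1" for x
    using order_wronskian_eq[of x] by linarith
  have "Polynomial.degree ?W \<le> (\<Sum>x\<in>?S. ram_index P Q (Aff x) - 1)"
    using degree_le_sum_orders[OF wronskian_nonzero fin roots] unfolding order_W .
  also have "\<dots> + (ram_index P Q Infty - 1) = (ram_index P Q \<gamma>1 - 1) + (ram_index P Q \<gamma>2 - 1)"
  proof (cases "Infty \<in> {\<gamma>1, \<gamma>2}")
    case True
    then obtain b where "{\<gamma>1, \<gamma>2} = {Infty, Aff b}" "ram_index P Q \<gamma>1 + ram_index P Q \<gamma>2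
        = ram_index P Q Infty + ram_index P Q (Aff b)"
      using distinct_critical by (cases \<gamma>1; cases \<gamma>2) auto
    moreover from this have "?S = {b}" by auto
    ultimately show ?thesis
      using ram_index_bounds[of \<gamma>1] ram_index_bounds[of \<gamma>2] ram_index_bounds[of Infty]
        ram_index_bounds[of "Aff b"] by simp
  next
    case False
    then obtain b1 b2 where b: "\<gamma>1 = Aff b1" "\<gamma>2 = Aff b2" by (cases \<gamma>1; cases \<gamma>2) auto
    then have "?S = {b1, b2}" "b1 \<noteq> b2" using distinct_critical by auto
    moreover have "\<not> ram_index P Q Infty > 1" using False ram_index_critical by blast
    ultimately show ?thesis using b by simp
  qed
  finally have *: "Polynomial.degree ?W + (ram_index P Q Infty - 1)
      \<le> (ram_index P Q \<gamma>1 - 1) + (ram_index P Q \<gamma>2 - 1)" by simp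
  show ?thesis
    using * degree_wronskian_eq ram_index_bounds[of \<gamma>1] ram_index_bounds[of \<gamma>2]
      ram_index_bounds[of Infty] by linarith
qed

text \<open>The member of the pencil at a totally ramified point is a form of degree \<open>d\<close> that vanishes there
  to order \<open>d\<close>, so up to a constant it is a power of the linear form.\<close>

lemma linear_power_in_pencil:
  assumes "x \<in> {\<gamma>1, \<gamma>2}" "heval 1 L x = 0" "Polynomial.degree L \<le> 1"
  shows "\<exists>a b. smult a P + smult b Q = L ^ d"
proof -
  have ram: "ram_index P Q x = d" using assms(1) totally_ramified by auto
  obtain c0 c1 where L: "L = [:c0, c1:]"
    using assms(3)
    by (cases L) (metis One_nat_def degree_eq_zeroE degree_pCons_eq_if le_zero_eq not_less_eq_eq pCons_0_0)
  have "\<exists>u. L ^ d = smult u (pencil_at x)"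
  proof (cases x)
    case (Aff b)
    have Lb: "L = smult c1 [:-b, 1:]"
      using assms(2) Aff L by (simp add: eq_neg_iff_add_eq_0 mult.commute)
    have "[:-b, 1:] ^ d dvd pencil_at x"
      using order_1[of b "pencil_at x"] ram unfolding Aff ram_index_Aff by simp
    then obtain S where S: "pencil_at x = [:-b, 1:] ^ d * S" by (elim dvdE)
    then have "S \<noteq> 0" using pencil_at_nonzero[of x] by auto
    with S have "Polynomial.degree (pencil_at x) = d + Polynomial.degree S"
      by (simp add: degree_mult_eq degree_power_eq)
    then have "Polynomial.degree S = 0" using degree_pencil_at[of x] by simp
    then obtain k where "S = [:k:]" by (rule degree_eq_zeroE)
    with S \<open>S \<noteq> 0\<close> have "k \<noteq> 0" "pencil_at x = smult k ([:-b, 1:] ^ d)" by auto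
    then have "L ^ d = smult (c1 ^ d / k) (pencil_at x)"
      unfolding Lb smult_power by simp
    then show ?thesis ..
  next
    case Infty
    have "Polynomial.degree (pencil_at x) = 0"
      using ram degree_pencil_at_Infty unfolding Infty ram_index_Infty by simp
    then obtain k where k: "pencil_at x = [:k:]" by (rule degree_eq_zeroE)
    have "L ^ d = [:c0 ^ d:]" using assms(2) Infty L by (simp add: poly_const_pow)
    then have "L ^ d = smult (c0 ^ d / k) (pencil_at x)"
      using k pencil_at_nonzero[of x] by simp
    then show ?thesis ..
  qed
  then show ?thesis
    unfolding pencil_at_def by (metis smult_add_right smult_smult)
qed

text \<open>With \<open>\<mu> = L1 / L2\<close> both \<open>L1 ^ d\<close> and \<open>L2 ^ d\<close> are in the pencil, so \<open>\<mu> ^ d\<close> is a fractional linear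
  expression in \<open>P / Q\<close>. It is invertible because the two powers have no common zero.\<close>

lemma power_map_normal_form_oriented:
  fixes a b c e :: 'a
  defines "\<mu> \<equiv> rat_map [:b, a:] [:e, c:]"
  assumes det: "a * e - b * c \<noteq> 0"
    and g: "\<mu> g1 = Aff 0" "\<mu> g2 = Infty" "{g1, g2} = {\<gamma>1, \<gamma>2}"
  shows "\<exists>\<nu>. bij \<nu> \<and> (\<forall>x. \<nu> (rat_map P Q x) = map_P1 (\<lambda>z. z ^ d) (\<mu> x))"
proof -
  let ?L1 = "[:b, a:]" and ?L2 = "[:e, c:]"
  have \<mu>: "\<mu> x = of_hom (heval 1 ?L1 x) (heval 1 ?L2 x)" for x
    unfolding \<mu>_def mobius_eq_of_hom[OF det] heval_linear ..
  have z: "heval 1 ?L1 g1 = 0" "heval 1 ?L2 g1 \<noteq> 0" "heval 1 ?L2 g2 = 0" "heval 1 ?L1 g2 \<noteq> 0"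
    using g(1,2) linear_map_nonzero[OF det hom_coords_nonzero, of g2]
    unfolding \<mu> of_hom_eq_0_iff of_hom_eq_Infty_iff heval_linear by auto
  have "g1 \<in> {\<gamma>1, \<gamma>2}" "g2 \<in> {\<gamma>1, \<gamma>2}" using g(3) by auto
  note pencil =
    linear_power_in_pencil[OF this(1) z(1)]
    linear_power_in_pencil[OF this(2) z(3)]
  obtain A B where AB: "smult A P + smult B Q = ?L1 ^ d"
    using pencil(1) degree_pCons_le[of b "[:a:]"] by auto
  obtain A' B' where AB': "smult A' P + smult B' Q = ?L2 ^ d"
    using pencil(2) degree_pCons_le[of e "[:c:]"] by auto
  have h1: "A * heval d P x + B * heval d Q x = heval 1 ?L1 x ^ d" for x
    unfolding heval_combination[symmetric] AB by (rule heval_power) simp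
  have h2: "A' * heval d P x + B' * heval d Q x = heval 1 ?L2 x ^ d" for x
    unfolding heval_combination[symmetric] AB' by (rule heval_power) simp
  have det': "A * B' - B * A' \<noteq> 0"
  proof
    assume 0: "A * B' - B * A' = 0"
    have "A' * (A * p + B * q) - A * (A' * p + B' * q) = - (A * B' - B * A') * q"
      "B' * (A * p + B * q) - B * (A' * p + B' * q) = (A * B' - B * A') * p" for p q
      by (simp_all add: algebra_simps)
    with 0 have "A' * (A * p + B * q) - A * (A' * p + B' * q) = 0"
      "B' * (A * p + B * q) - B * (A' * p + B' * q) = 0" for p q by simp_all
    from this[of "heval d P g1" "heval d Q g1"] have "A = 0" "B = 0"
      unfolding h1 h2 using z d_ge_2 by (auto simp: power_0_left)
    with h1[of g2] z d_ge_2 show False by auto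
  qed
  define \<nu> where "\<nu> = rat_map [:B, A:] [:B', A':]"
  have "\<nu> (rat_map P Q x) = map_P1 (\<lambda>z. z ^ d) (\<mu> x)" for x
  proof -
    obtain k where k: "k \<noteq> 0" "heval d P x = k * hom_x (rat_map P Q x)"
      "heval d Q x = k * hom_y (rat_map P Q x)"
      unfolding rat_map_eq_of_hom degree_eq by (rule hom_of_hom[OF heval_nonzero])
    have "\<nu> (rat_map P Q x) = of_hom (k * (A * hom_x (rat_map P Q x) + B * hom_y (rat_map P Q x)))
        (k * (A' * hom_x (rat_map P Q x) + B' * hom_y (rat_map P Q x)))"
      unfolding \<nu>_def mobius_eq_of_hom[OF det'] of_hom_scale[OF k(1)] ..
    also have "\<dots> = of_hom (A * heval d P x + B * heval d Q x) (A' * heval d P x + B' * heval d Q x)"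
      unfolding k(2,3) by (simp add: algebra_simps)
    also have "\<dots> = map_P1 (\<lambda>z. z ^ d) (\<mu> x)"
      unfolding h1 h2 \<mu> by (rule map_power_of_hom[symmetric]) (use d_ge_2 in simp)
    finally show ?thesis .
  qed
  moreover have "bij \<nu>" unfolding \<nu>_def by (rule bij_mobius[OF det'])
  ultimately show ?thesis by blast
qed

lemma power_map_normal_form:
  assumes "\<mu> \<in> mobius_maps F" "\<mu> ` {\<gamma>1, \<gamma>2} = {Aff 0, Infty}"
  shows "\<exists>\<nu>. bij \<nu> \<and> (\<forall>x. \<nu> (rat_map P Q x) = map_P1 (\<lambda>z. z ^ d) (\<mu> x))"
proof -
  obtain a b c e where \<mu>: "\<mu> = rat_map [:b, a:] [:e, c:]" "a * e - b * c \<noteq> 0"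
    using assms(1) unfolding mobius_maps_def by blast
  consider "\<mu> \<gamma>1 = Aff 0" "\<mu> \<gamma>2 = Infty" | "\<mu> \<gamma>2 = Aff 0" "\<mu> \<gamma>1 = Infty"
    using assms(2) by (auto simp: doubleton_eq_iff)
  then show ?thesis
    using power_map_normal_form_oriented[OF \<mu>(2), of \<gamma>1 \<gamma>2]
      power_map_normal_form_oriented[OF \<mu>(2), of \<gamma>2 \<gamma>1] unfolding \<mu>(1)
    by cases (auto simp: insert_commute)
qed

end

section \<open>Roots of unity\<close>

definition primitive_root_of_unity :: "nat \<Rightarrow> 'a::field \<Rightarrow> bool" where
  "primitive_root_of_unity n \<omega> \<longleftrightarrow> (\<forall>k. \<omega> ^ k = 1 \<longleftrightarrow> n dvd k)"

text \<open>A root of \<open>1 + z + \<dots> + z ^ (p - 1)\<close>; this polynomial takes the value \<open>p \<noteq> 0\<close> at \<open>1\<close>.\<close>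

lemma nontrivial_root_of_unity:
  assumes "p \<ge> 2" "of_nat p \<noteq> (0::'a::alg_closed_field)"
  shows "\<exists>\<eta>::'a. \<eta> ^ p = 1 \<and> \<eta> \<noteq> 1"
proof -
  obtain \<eta> :: 'a where \<eta>: "(\<Sum>k\<le>p - 1. 1 * \<eta> ^ k) = 0"
    using alg_closed[of "p - 1" "\<lambda>_. 1 :: 'a"] assms(1) by auto
  moreover have "{..p - 1} = {..<p}" using assms(1) by auto
  ultimately have "(\<Sum>k<p. \<eta> ^ k) = 0" by simp
  moreover from this have "\<eta> \<noteq> 1" using assms(2) by auto
  ultimately show ?thesis using power_diff_1_eq[of \<eta> p] by auto
qed

text \<open>Given a primitive \<open>n\<close>-th root of unity \<open>y\<close>, a \<open>p\<close>-th root \<open>x\<close> of \<open>y\<close> is a primitive \<open>p n\<close>-th root of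
  unity as soon as \<open>x ^ n \<noteq> 1\<close>. If \<open>x ^ n = 1\<close>, then \<open>p\<close> is prime to \<open>n\<close>, since otherwise
  \<open>y ^ (n / p) = 1\<close>; so multiplying \<open>x\<close> with a nontrivial \<open>p\<close>-th root of unity repairs it.\<close>

lemma ex_primitive_root_of_unity:
  assumes "n > 0" "of_nat n \<noteq> (0::'a::alg_closed_field)"
  shows "\<exists>\<omega>::'a. primitive_root_of_unity n \<omega>"
  using assms
proof (induction n rule: prime_divisors_induct)
  case (unit n)
  then have "primitive_root_of_unity n (1::'a)" by (simp add: primitive_root_of_unity_def)
  then show ?case ..
next
  case (factor p n)
  then have p: "prime p" and n: "n > 0" "of_nat n \<noteq> (0::'a)" "of_nat p \<noteq> (0::'a)" by auto
  then obtain y :: 'a where y: "y ^ k = 1 \<longleftrightarrow> n dvd k" for k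
    using factor.IH unfolding primitive_root_of_unity_def by blast
  obtain x0 :: 'a where x0: "x0 ^ p = y" using nth_root_exists prime_gt_0_nat[OF p] by blast
  have "\<exists>x. x ^ p = y \<and> x ^ n \<noteq> 1"
  proof (cases "x0 ^ n = 1")
    case True
    have "\<not> p dvd n"
    proof
      assume "p dvd n"
      then obtain m where m: "n = p * m" ..
      then have "y ^ m = 1" using True by (simp add: x0[symmetric] power_mult)
      then show False using y m n(1) prime_gt_1_nat[OF p] by (auto dest: dvd_imp_le)
    qed
    then obtain u v where uv: "n * u = Suc (p * v)"
      using bezout_prime[OF p, of n] by auto
    obtain \<eta> :: 'a where \<eta>: "\<eta> ^ p = 1" "\<eta> \<noteq> 1"
      using nontrivial_root_of_unity[OF prime_ge_2_nat[OF p] n(3)] by blast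
    have "\<eta> ^ n \<noteq> 1"
    proof
      assume "\<eta> ^ n = 1"
      then have "\<eta> ^ (n * u) = 1" by (simp add: power_mult)
      then show False unfolding uv using \<eta> by (simp add: power_mult)
    qed
    then show ?thesis using x0 \<eta>(1) True
      by (intro exI[of _ "\<eta> * x0"]) (simp add: power_mult_distrib)
  qed (use x0 in blast)
  then obtain x where x: "x ^ p = y" "x ^ n \<noteq> 1" by blast
  have "x ^ k = 1 \<longleftrightarrow> p * n dvd k" for k
  proof
    assume k: "x ^ k = 1"
    have "y ^ k = (x ^ k) ^ p" by (simp add: x(1)[symmetric] power_mult[symmetric] mult.commute)
    then have "y ^ k = 1" using k by simp
    then have "n dvd k" using y by simp
    then obtain i where i: "k = n * i" ..
    have xp: "(x ^ n) ^ p = 1" using y[of n] by (simp add: x(1)[symmetric] power_mult[symmetric] mult.commute)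
    have "p dvd i"
    proof (rule ccontr)
      assume "\<not> p dvd i"
      then obtain u v where uv: "i * u = Suc (p * v)"
        using bezout_prime[OF p, of i] by auto
      have "(x ^ n) ^ (i * u) = 1" using k i by (simp add: power_mult)
      then show False unfolding uv using x(2) xp by (simp add: power_mult)
    qed
    then show "p * n dvd k" using i by (simp add: mult.commute)
  next
    assume "p * n dvd k"
    then obtain m where "k = p * (n * m)" by (metis dvdE mult.assoc)
    then have "x ^ k = (y ^ n) ^ m" using x(1) by (simp add: power_mult)
    then show "x ^ k = 1" using y[of n] by simp
  qed
  then show ?case unfolding primitive_root_of_unity_def by blast
qed simp

lemma primitive_root_power_eq_iff:
  assumes "primitive_root_of_unity n \<omega>" "n > 0"
  shows "\<omega> ^ i = \<omega> ^ j \<longleftrightarrow> i mod n = j mod n"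
proof -
  have \<omega>: "\<omega> ^ k = 1 \<longleftrightarrow> n dvd k" for k
    using assms(1) unfolding primitive_root_of_unity_def by blast
  have "\<omega> \<noteq> 0"
  proof
    assume "\<omega> = 0"
    with \<omega>[of n] assms(2) show False by (simp add: power_0_left)
  qed
  have *: "\<omega> ^ i = \<omega> ^ (i + k) \<longleftrightarrow> i mod n = (i + k) mod n" for i k
  proof -
    have "\<omega> ^ i = \<omega> ^ (i + k) \<longleftrightarrow> \<omega> ^ k = 1" using \<open>\<omega> \<noteq> 0\<close> by (simp add: power_add)
    also have "\<dots> \<longleftrightarrow> n dvd i + k - i" using \<omega> by simp
    finally show ?thesis using mod_eq_dvd_iff_nat[of i "i + k" n] by auto
  qed
  show ?thesis using *[of i "j - i"] *[of j "i - j"] by (cases "i \<le> j") auto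
qed

text \<open>The powers are \<open>n\<close> distinct roots of \<open>z ^ n - 1\<close>, which has no more than \<open>n\<close>.\<close>

lemma roots_of_unity_eq_powers:
  assumes \<omega>: "primitive_root_of_unity n (\<omega>::'a::field)" and "n > 0"
  shows "{\<zeta>. \<zeta> ^ n = 1} = (\<lambda>i. \<omega> ^ i) ` {..<n}"
proof (rule sym, rule card_seteq)
  have p: "{\<zeta>::'a. \<zeta> ^ n = 1} = {\<zeta>. poly (Polynomial.monom 1 n - 1) \<zeta> = 0}"
    by (simp add: poly_monom)
  have nz: "Polynomial.monom 1 n - 1 \<noteq> (0::'a poly)"
    using \<open>n > 0\<close> by (metis degree_1 degree_monom_eq eq_iff_diff_eq_0 less_irrefl zero_neq_one)
  show "finite {\<zeta>::'a. \<zeta> ^ n = 1}" unfolding p by (rule poly_roots_finite[OF nz])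
  have "card {\<zeta>::'a. \<zeta> ^ n = 1} \<le> Polynomial.degree (Polynomial.monom 1 n - 1 :: 'a poly)"
    unfolding p by (rule card_poly_roots_bound[OF nz])
  also have "\<dots> \<le> n" by (rule degree_diff_le) (simp_all add: degree_monom_le)
  also have "n = card ((\<lambda>i. \<omega> ^ i) ` {..<n})"
    by (subst card_image) (auto simp: inj_on_def primitive_root_power_eq_iff[OF assms])
  finally show "card {\<zeta>::'a. \<zeta> ^ n = 1} \<le> card ((\<lambda>i. \<omega> ^ i) ` {..<n})" .
  show "(\<lambda>i. \<omega> ^ i) ` {..<n} \<subseteq> {\<zeta>. \<zeta> ^ n = 1}"
    using \<omega> by (auto simp: primitive_root_of_unity_def power_mult[symmetric])
qed

section \<open>Subfields and Galois groups\<close>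

abbreviation is_subfield :: "'a::field set \<Rightarrow> bool" where
  "is_subfield F \<equiv> subfield F ring_of_type_algebra"

lemma ring_of_type_algebra_ops [simp]:
  "carrier (ring_of_type_algebra :: 'a::field ring) = UNIV"
  "\<one>\<^bsub>ring_of_type_algebra\<^esub> = (1::'a)" "\<zero>\<^bsub>ring_of_type_algebra\<^esub> = (0::'a)"
  "x \<otimes>\<^bsub>ring_of_type_algebra\<^esub> y = x * (y::'a)" "x \<oplus>\<^bsub>ring_of_type_algebra\<^esub> y = x + (y::'a)"
  by (simp_all add: ring_of_type_algebra_def)

lemma ring_of_type_algebra_inverses:
  fixes x :: "'a::field"
  shows "\<ominus>\<^bsub>ring_of_type_algebra\<^esub> x = - x"
    and "x \<noteq> 0 \<Longrightarrow> inv\<^bsub>ring_of_type_algebra\<^esub> x = inverse x"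
proof -
  interpret R: Ring.field "ring_of_type_algebra :: 'a ring" ..
  show "\<ominus>\<^bsub>ring_of_type_algebra\<^esub> x = - x"
    using R.minus_equality[of "- x" x] by simp
  show "inv\<^bsub>ring_of_type_algebra\<^esub> x = inverse x" if "x \<noteq> 0"
    using R.comm_inv_char[of x "inverse x"] that by simp
qed

lemma is_subfieldI:
  fixes F :: "'a::field set"
  assumes "1 \<in> F" "\<And>x. x \<in> F \<Longrightarrow> - x \<in> F" "\<And>x. x \<in> F \<Longrightarrow> x \<noteq> 0 \<Longrightarrow> inverse x \<in> F"
    and "\<And>x y. x \<in> F \<Longrightarrow> y \<in> F \<Longrightarrow> x + y \<in> F" "\<And>x y. x \<in> F \<Longrightarrow> y \<in> F \<Longrightarrow> x * y \<in> F"
  shows "is_subfield F"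
proof -
  interpret R: Ring.field "ring_of_type_algebra :: 'a ring" ..
  show ?thesis
    by (rule R.subfieldI', rule R.subringI)
      (auto simp: ring_of_type_algebra_inverses assms)
qed

text \<open>Closure under inverses and quotients includes the value \<open>0\<close> of \<open>inverse 0\<close>.\<close>

lemma is_subfield_closed:
  fixes F :: "'a::field set"
  assumes "is_subfield F"
  shows "0 \<in> F" "1 \<in> F" "x \<in> F \<Longrightarrow> - x \<in> F" "x \<in> F \<Longrightarrow> inverse x \<in> F"
    "x \<in> F \<Longrightarrow> y \<in> F \<Longrightarrow> x + y \<in> F" "x \<in> F \<Longrightarrow> y \<in> F \<Longrightarrow> x * y \<in> F"
    "x \<in> F \<Longrightarrow> y \<in> F \<Longrightarrow> x / y \<in> F"
proof -
  interpret R: Ring.field "ring_of_type_algebra :: 'a ring" ..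
  note sub = subfieldE(1)[OF assms]
  show z: "0 \<in> F" and "1 \<in> F" using subringE(2,3)[OF sub] by auto
  show m: "- x \<in> F" if "x \<in> F" for x
    using subringE(5)[OF sub that] by (simp add: ring_of_type_algebra_inverses)
  show i: "inverse x \<in> F" if "x \<in> F" for x
    using R.subfield_m_inv(1)[OF assms, of x] that z
    by (cases "x = 0") (auto simp: ring_of_type_algebra_inverses)
  show a: "x + y \<in> F" if "x \<in> F" "y \<in> F" for x y using subringE(7)[OF sub that] by simp
  show t: "x * y \<in> F" if "x \<in> F" "y \<in> F" for x y using subringE(6)[OF sub that] by simp
  show "x / y \<in> F" if "x \<in> F" "y \<in> F" using t[OF that(1) i[OF that(2)]] by (simp add: field_simps)
qed

lemma is_subfield_adjoin: "is_subfield (adjoin F S)"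
  unfolding adjoin_def by (intro field.generate_field_is_subfield field_from_type_algebra) simp

lemma adjoin_superset: "F \<subseteq> adjoin F S" "Aff x \<in> S \<Longrightarrow> x \<in> adjoin F S"
  unfolding adjoin_def by (auto intro: generate_field.incl)

lemma adjoin_least:
  assumes "is_subfield L" "F \<subseteq> L" "\<And>x. Aff x \<in> S \<Longrightarrow> x \<in> L"
  shows "adjoin F S \<subseteq> L"
  unfolding adjoin_def using assms
  by (intro field.generate_field_min_subfield1 field_from_type_algebra) auto

lemma is_subfield_Union_chain:
  assumes "\<And>n::nat. is_subfield (L n)" "\<And>n. L n \<subseteq> L (Suc n)"
  shows "is_subfield (\<Union>n\<in>{1..}. L n)"
proof -
  have mono: "L m \<subseteq> L n" if "m \<le> n" for m n using lift_Suc_mono_le[of L] assms(2) that by blast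
  have two: "\<exists>n\<ge>1. x \<in> L n \<and> y \<in> L n" if xy: "x \<in> \<Union> (L ` {1..})" "y \<in> \<Union> (L ` {1..})" for x y
  proof -
    obtain m n where "m \<in> {1..}" "x \<in> L m" "n \<in> {1..}" "y \<in> L n" using xy by blast
    then show ?thesis using mono[of m "max m n"] mono[of n "max m n"]
      by (intro exI[of _ "max m n"]) auto
  qed
  note cl = is_subfield_closed[OF assms(1)]
  show ?thesis
  proof (rule is_subfieldI)
    fix x y assume "x \<in> \<Union> (L ` {1..})" "y \<in> \<Union> (L ` {1..})"
    then obtain n where "n \<ge> 1" "x \<in> L n" "y \<in> L n" using two by blast
    then show "x + y \<in> \<Union> (L ` {1..})" "x * y \<in> \<Union> (L ` {1..})"
      using cl(5,6)[of x n y] by auto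
  next
    show "1 \<in> \<Union> (L ` {1..})" using cl(2) by blast
    show "- x \<in> \<Union> (L ` {1..})" "inverse x \<in> \<Union> (L ` {1..})" if "x \<in> \<Union> (L ` {1..})" for x
      using that cl(3,4) by blast+
  qed
qed

definition points_over :: "'a set \<Rightarrow> 'a P1 set" where
  "points_over L = {x. set_P1 x \<subseteq> L}"

lemma points_over_simps [simp]:
  "Aff x \<in> points_over L \<longleftrightarrow> x \<in> L" "Infty \<in> points_over L"
  by (simp_all add: points_over_def)

lemma points_over_mono: "L \<subseteq> M \<Longrightarrow> points_over L \<subseteq> points_over M"
  by (auto simp: points_over_def)

lemma in_points_over_adjoin: "x \<in> S \<Longrightarrow> x \<in> points_over (adjoin F S)"
  by (cases x) (auto intro: adjoin_superset)

lemma poly_in_subfield: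
  assumes L: "is_subfield L" and "\<And>i. Polynomial.coeff P i \<in> L" and x: "x \<in> L"
  shows "poly P x \<in> L"
  using assms(2)
proof (induction P)
  case (pCons a p)
  from pCons.prems[of 0] have "a \<in> L" by simp
  moreover have "poly p x \<in> L"
  proof (rule pCons.IH)
    show "Polynomial.coeff p i \<in> L" for i using pCons.prems[of "Suc i"] by simp
  qed
  ultimately show ?case using x by (simp add: is_subfield_closed[OF L])
qed (simp add: is_subfield_closed[OF L])

lemma rat_map_in_points_over:
  assumes "is_subfield L" "\<And>i. Polynomial.coeff P i \<in> L" "\<And>i. Polynomial.coeff Q i \<in> L"
    and "x \<in> points_over L"
  shows "rat_map P Q x \<in> points_over L"
  using assms
  by (cases x) (auto simp: Let_def intro!: is_subfield_closed(7) poly_in_subfield)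

lemma Gal_mult:
  assumes "\<sigma> \<in> carrier (Gal L F)" "\<tau> \<in> carrier (Gal L F)"
  shows "\<sigma> \<otimes>\<^bsub>Gal L F\<^esub> \<tau> = compose L \<sigma> \<tau>"
  using assms by (simp add: Gal_def BijGroup_def)

locale field_automorphism =
  fixes L F :: "'a::field set" and \<sigma> :: "'a \<Rightarrow> 'a"
  assumes subfield_L: "is_subfield L" and subset: "F \<subseteq> L" and \<sigma>: "\<sigma> \<in> carrier (Gal L F)"
begin

lemma automorphism_facts:
  shows bij: "bij_betw \<sigma> L L" and ext: "\<sigma> \<in> extensional L"
    and add: "x \<in> L \<Longrightarrow> y \<in> L \<Longrightarrow> \<sigma> (x + y) = \<sigma> x + \<sigma> y"
    and mult: "x \<in> L \<Longrightarrow> y \<in> L \<Longrightarrow> \<sigma> (x * y) = \<sigma> x * \<sigma> y"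
    and fixed: "x \<in> F \<Longrightarrow> \<sigma> x = x"
  using \<sigma> by (auto simp: Gal_def Bij_def)

lemma eq_iff: "x \<in> L \<Longrightarrow> y \<in> L \<Longrightarrow> \<sigma> x = \<sigma> y \<longleftrightarrow> x = y"
  using bij by (auto simp: bij_betw_def dest: inj_onD)

lemmas L_closed = is_subfield_closed[OF subfield_L]

lemma zero: "\<sigma> 0 = 0"
  using add[OF L_closed(1) L_closed(1)] by (metis add_cancel_right_right)

lemma one: "\<sigma> 1 = 1"
  using mult[of 1 1] eq_iff[of 1 0] by (simp add: L_closed zero)

lemma minus: "x \<in> L \<Longrightarrow> \<sigma> (- x) = - \<sigma> x"
  using add[of x "- x"] by (simp add: L_closed zero eq_neg_iff_add_eq_0 add.commute)

lemma inverse: "x \<in> L \<Longrightarrow> \<sigma> (inverse x) = inverse (\<sigma> x)"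
  using mult[of x "inverse x"] by (cases "x = 0") (auto simp: L_closed zero one intro: inverse_unique[symmetric])

lemma divide: "x \<in> L \<Longrightarrow> y \<in> L \<Longrightarrow> \<sigma> (x / y) = \<sigma> x / \<sigma> y"
  by (simp add: divide_inverse mult inverse L_closed)

lemma poly_commute:
  assumes "\<And>i. Polynomial.coeff P i \<in> F" "x \<in> L"
  shows "\<sigma> (poly P x) = poly P (\<sigma> x)"
  using assms(1)
proof (induction P)
  case (pCons a p)
  have a: "a \<in> F" using pCons.prems[of 0] by simp
  have p: "Polynomial.coeff p i \<in> F" for i using pCons.prems[of "Suc i"] by simp
  then have "poly p x \<in> L" using subset assms(2) by (intro poly_in_subfield[OF subfield_L]) auto
  with a subset assms(2) pCons.IH[OF p] show ?case
    by (auto simp: add mult L_closed fixed)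
qed (simp add: zero)

text \<open>Coefficients in \<open>F\<close> are fixed. Poles correspond because \<open>\<sigma>\<close> is injective.\<close>

lemma rat_map_commute:
  assumes "\<And>i. Polynomial.coeff P i \<in> F" "\<And>i. Polynomial.coeff Q i \<in> F" "x \<in> points_over L"
  shows "map_P1 \<sigma> (rat_map P Q x) = rat_map P Q (map_P1 \<sigma> x)"
proof (cases x)
  case (Aff z)
  then have z: "z \<in> L" using assms(3) by simp
  have in_L: "poly P z \<in> L" "poly Q z \<in> L"
    using assms(1,2) subset z by (auto intro!: poly_in_subfield[OF subfield_L])
  then have "\<sigma> (poly Q z) = 0 \<longleftrightarrow> poly Q z = 0" using eq_iff[of _ 0] by (simp add: zero L_closed)
  then show ?thesis
    using Aff in_L by (simp add: divide poly_commute[OF assms(1) z, symmetric]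
        poly_commute[OF assms(2) z, symmetric])
next
  case Infty
  have "Polynomial.coeff P i \<in> L" "Polynomial.coeff Q i \<in> L" for i using assms(1,2) subset by auto
  then show ?thesis using Infty assms(1,2) by (simp add: Let_def divide fixed)
qed

lemma map_P1_eq_iff:
  "x \<in> points_over L \<Longrightarrow> y \<in> points_over L \<Longrightarrow> map_P1 \<sigma> x = map_P1 \<sigma> y \<longleftrightarrow> x = y"
  by (cases x; cases y) (auto simp: eq_iff)

lemma map_P1_scale:
  assumes "\<zeta> \<in> L" "x \<in> points_over L"
  shows "map_P1 \<sigma> (map_P1 ((*) \<zeta>) x) = map_P1 ((*) (\<sigma> \<zeta>)) (map_P1 \<sigma> x)"
  using assms by (cases x) (auto simp: mult)

end

lemma map_P1_compose:
  "x \<in> points_over L \<Longrightarrow> map_P1 (compose L \<sigma> \<tau>) x = map_P1 \<sigma> (map_P1 \<tau> x)"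
  by (cases x) (auto simp: compose_def)

text \<open>The elements on which \<open>\<sigma>\<close> and \<open>\<tau>\<close> agree form a field, and it contains all generators.\<close>

lemma automorphisms_agree_on_adjoin:
  assumes L: "is_subfield L" "F \<subseteq> L"
    and \<sigma>: "\<sigma> \<in> carrier (Gal L F)" and \<tau>: "\<tau> \<in> carrier (Gal L F)"
    and S: "\<And>x. x \<in> S \<Longrightarrow> x \<in> points_over L \<and> map_P1 \<sigma> x = map_P1 \<tau> x"
    and z: "z \<in> adjoin F S"
  shows "\<sigma> z = \<tau> z"
proof -
  interpret S: field_automorphism L F \<sigma> by (intro field_automorphism.intro L \<sigma>)
  interpret T: field_automorphism L F \<tau> by (intro field_automorphism.intro L \<tau>)
  have "is_subfield {x \<in> L. \<sigma> x = \<tau> x}"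
    by (rule is_subfieldI)
      (auto simp: S.L_closed S.one T.one S.minus T.minus S.inverse T.inverse S.add T.add S.mult T.mult)
  then have "adjoin F S \<subseteq> {x \<in> L. \<sigma> x = \<tau> x}"
    by (rule adjoin_least) (use L(2) S in \<open>force simp: S.fixed T.fixed\<close>)+
  with z show ?thesis by blast
qed

section \<open>The tree of preimages in a coordinate in which the map is a power map\<close>

lemma group_roots_of_unity: "d > 0 \<Longrightarrow> group (roots_of_unity_group d :: 'a::field monoid)"
proof (rule groupI)
  fix x :: 'a assume "d > 0" and x: "x \<in> carrier (roots_of_unity_group d)"
  then have "x \<noteq> 0" by (auto simp: roots_of_unity_group_def power_0_left)
  then show "\<exists>y\<in>carrier (roots_of_unity_group d).
      y \<otimes>\<^bsub>roots_of_unity_group d\<^esub> x = \<one>\<^bsub>roots_of_unity_group d\<^esub>"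
    using x by (intro bexI[of _ "inverse x"]) (auto simp: roots_of_unity_group_def power_inverse)
qed (auto simp: roots_of_unity_group_def power_mult_distrib)

lemma cycle_of_list_upt_funpow:
  assumes "x < d"
  shows "(cycle_of_list [0..<d] ^^ k) x = (x + k) mod d"
proof -
  have "map (cycle_of_list [0..<d] ^^ k) [0..<d] = rotate k [0..<d]"
    by (rule cyclic_rotation) simp
  then have "map (cycle_of_list [0..<d] ^^ k) [0..<d] ! x = rotate k [0..<d] ! x" by simp
  then show ?thesis using assms by (simp add: nth_rotate add.commute)
qed

text \<open>The polynomials \<open>M\<close> and \<open>N\<close> only serve to express that the coordinate \<open>\<mu>\<close> is defined over
  \<open>F\<close>. The assumption \<open>unramified\<close> is how it enters that \<open>\<alpha>\<close> is not post-critical.\<close>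

locale preimage_tree =
  fixes P Q M N :: "'a::alg_closed_field poly" and \<phi> \<mu> \<nu> :: "'a P1 \<Rightarrow> 'a P1"
    and d :: nat and F :: "'a set" and \<alpha> \<omega> :: 'a
  assumes \<phi>_def: "\<phi> = rat_map P Q" and \<mu>_def: "\<mu> = rat_map M N"
    and subfield_F: "is_subfield F" and \<alpha>_in_F: "\<alpha> \<in> F"
    and coeffs_\<phi>: "Polynomial.coeff P i \<in> F" "Polynomial.coeff Q i \<in> F"
    and coeffs_\<mu>: "Polynomial.coeff M i \<in> F" "Polynomial.coeff N i \<in> F"
    and bij_\<mu>: "bij \<mu>" and bij_\<nu>: "bij \<nu>"
    and normal_form: "\<nu> (\<phi> x) = map_P1 (\<lambda>z. z ^ d) (\<mu> x)"
    and d_pos: "d > 0" and \<omega>: "primitive_root_of_unity d \<omega>"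
    and unramified: "n \<ge> 1 \<Longrightarrow> (\<phi> ^^ n) x = Aff \<alpha> \<Longrightarrow> \<mu> x \<notin> {Aff 0, Infty}"
begin

abbreviation rot :: "'a \<Rightarrow> 'a P1 \<Rightarrow> 'a P1" where "rot \<equiv> mult_via \<mu>"

abbreviation level :: "nat \<Rightarrow> 'a P1 set" where "level n \<equiv> preimages \<phi> n (Aff \<alpha>)"

abbreviation Kn :: "nat \<Rightarrow> 'a set" where "Kn n \<equiv> adjoin F (level n)"

abbreviation Kinf :: "'a set" where "Kinf \<equiv> \<Union>n\<in>{1..}. Kn n"

lemma \<mu>_rot: "\<mu> (rot \<zeta> x) = map_P1 ((*) \<zeta>) (\<mu> x)"
  unfolding mult_via_def using bij_\<mu> by (simp add: f_the_inv_into_f_bij_betw)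

lemma \<mu>_eq_iff: "\<mu> x = \<mu> y \<longleftrightarrow> x = y"
  using bij_\<mu> by (meson bij_is_inj inj_eq)

lemma rot_one [simp]: "rot 1 x = x"
proof -
  have "map_P1 ((*) 1) y = y" for y :: "'a P1" by (cases y) auto
  then show ?thesis by (subst \<mu>_eq_iff[symmetric]) (simp add: \<mu>_rot)
qed

lemma rot_rot: "rot \<zeta> (rot \<eta> x) = rot (\<zeta> * \<eta>) x"
proof -
  have "map_P1 ((*) \<zeta>) (map_P1 ((*) \<eta>) y) = map_P1 ((*) (\<zeta> * \<eta>)) y" for y
    by (cases y) auto
  then show ?thesis by (subst \<mu>_eq_iff[symmetric]) (simp add: \<mu>_rot)
qed

lemma \<phi>_eq_iff: "\<phi> x = \<phi> y \<longleftrightarrow> map_P1 (\<lambda>z. z ^ d) (\<mu> x) = map_P1 (\<lambda>z. z ^ d) (\<mu> y)"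
  unfolding normal_form[symmetric] by (rule inj_eq[OF bij_is_inj[OF bij_\<nu>], symmetric])

lemma \<phi>_rot: "\<zeta> ^ d = 1 \<Longrightarrow> \<phi> (rot \<zeta> x) = \<phi> x"
  unfolding \<phi>_eq_iff \<mu>_rot by (cases "\<mu> x") (auto simp: power_mult_distrib)

text \<open>In the coordinate \<open>\<mu>\<close> the two points have equal \<open>d\<close>-th powers, so their ratio is a root of unity;
  \<open>0\<close> and \<open>\<infinity>\<close> are alone in their fibers.\<close>

lemma ex_rot:
  assumes "\<phi> y = \<phi> x"
  shows "\<exists>\<zeta>. \<zeta> ^ d = 1 \<and> y = rot \<zeta> x"
proof -
  have eq: "map_P1 (\<lambda>z. z ^ d) (\<mu> x) = map_P1 (\<lambda>z. z ^ d) (\<mu> y)"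
    using assms \<phi>_eq_iff by metis
  have "\<exists>\<zeta>. \<zeta> ^ d = 1 \<and> \<mu> y = map_P1 ((*) \<zeta>) (\<mu> x)"
  proof (cases "\<mu> x")
    case (Aff a)
    then obtain b where b: "\<mu> y = Aff b" "a ^ d = b ^ d" using eq by (cases "\<mu> y") auto
    show ?thesis
    proof (cases "a = 0")
      case True
      then show ?thesis using b Aff d_pos by (intro exI[of _ 1]) (auto simp: power_0_left)
    next
      case False
      then show ?thesis using b Aff d_pos
        by (intro exI[of _ "b / a"]) (auto simp: power_divide power_0_left)
    qed
  next
    case Infty
    then show ?thesis using eq by (intro exI[of _ 1]) (cases "\<mu> y", auto)
  qed
  then show ?thesis unfolding \<mu>_rot[symmetric] \<mu>_eq_iff .
qed

lemma surj_\<phi>: "surj \<phi>"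
proof (rule surjI)
  fix y
  have "\<exists>x. \<phi> x = y"
  proof -
    have "\<exists>w. map_P1 (\<lambda>z. z ^ d) w = \<nu> y"
    proof (cases "\<nu> y")
      case (Aff c)
      obtain b where "b ^ d = c" using nth_root_exists[OF d_pos] by blast
      with Aff show ?thesis by (intro exI[of _ "Aff b"]) simp
    next
      case Infty
      then show ?thesis by (intro exI[of _ Infty]) simp
    qed
    then obtain x where "map_P1 (\<lambda>z. z ^ d) (\<mu> x) = \<nu> y"
      using bij_is_surj[OF bij_\<mu>] by (metis surjD)
    then have "\<nu> (\<phi> x) = \<nu> y" unfolding normal_form .
    then show ?thesis using bij_is_inj[OF bij_\<nu>] by (auto dest: injD)
  qed
  then show "\<phi> (SOME x. \<phi> x = y) = y" by (rule someI_ex)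
qed

lemma level_0: "level 0 = {Aff \<alpha>}"
  by (auto simp: preimages_def)

lemma level_Suc: "x \<in> level (Suc n) \<longleftrightarrow> \<phi> x \<in> level n"
  by (simp add: preimages_def funpow_swap1)

lemma rot_in_level: "n \<ge> 1 \<Longrightarrow> \<zeta> ^ d = 1 \<Longrightarrow> x \<in> level n \<Longrightarrow> rot \<zeta> x \<in> level n"
  by (cases n) (auto simp: level_Suc \<phi>_rot)

text \<open>The action is free, because only \<open>0\<close> and \<open>\<infinity>\<close> have nontrivial stabilizers under multiplication.\<close>

lemma rot_eq_iff:
  assumes "x \<in> level n" "n \<ge> 1"
  shows "rot \<zeta> x = rot \<eta> x \<longleftrightarrow> \<zeta> = \<eta>"
proof -
  have "\<mu> x \<notin> {Aff 0, Infty}" using unramified assms by (simp add: preimages_def)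
  then obtain a where "\<mu> x = Aff a" "a \<noteq> 0" by (cases "\<mu> x") auto
  then show ?thesis unfolding \<mu>_eq_iff[symmetric, of "rot \<zeta> x"] \<mu>_rot by simp
qed

lemma ex_rot_power:
  assumes "\<phi> y = \<phi> x"
  shows "\<exists>k<d. y = rot (\<omega> ^ k) x"
proof -
  obtain \<zeta> where "\<zeta> ^ d = 1" "y = rot \<zeta> x" using ex_rot[OF assms] by blast
  moreover from this have "\<zeta> \<in> (\<lambda>i. \<omega> ^ i) ` {..<d}"
    using roots_of_unity_eq_powers[OF \<omega> d_pos] by blast
  ultimately show ?thesis by blast
qed

lemma \<omega>_root: "(\<omega> ^ k) ^ d = 1"
  using \<omega> by (simp add: primitive_root_of_unity_def power_mult[symmetric])

subsection \<open>The action of the roots of unity\<close>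

lemma rot_Bij:
  assumes "n \<ge> 1" "\<zeta> ^ d = 1"
  shows "restrict (rot \<zeta>) (level n) \<in> Bij (level n)"
proof -
  have "\<zeta> \<noteq> 0" using assms(2) d_pos by (auto simp: power_0_left)
  have inv: "inverse \<zeta> ^ d = 1" using assms(2) by (simp add: power_inverse)
  have "bij_betw (rot \<zeta>) (level n) (level n)"
    by (rule bij_betw_byWitness[where f' = "rot (inverse \<zeta>)"])
      (use \<open>\<zeta> \<noteq> 0\<close> inv assms in \<open>auto simp: rot_rot rot_in_level\<close>)
  then show ?thesis by (simp add: Bij_def cong: bij_betw_cong)
qed

lemma roots_of_unity_action:
  assumes "n \<ge> 1"
  shows "group_action (roots_of_unity_group d) (level n) (\<lambda>\<zeta>. restrict (rot \<zeta>) (level n))"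
  unfolding group_action_def
proof (intro group_hom.intro group_hom_axioms.intro homI)
  show "group (roots_of_unity_group d :: 'a monoid)" by (rule group_roots_of_unity[OF d_pos])
  show "group (BijGroup (level n))" by (rule group_BijGroup)
  fix x y :: 'a
  assume xy: "x \<in> carrier (roots_of_unity_group d)" "y \<in> carrier (roots_of_unity_group d)"
  have "compose (level n) (restrict (rot x) (level n)) (restrict (rot y) (level n))
      = restrict (rot (x * y)) (level n)"
    using xy assms by (auto simp: compose_def roots_of_unity_group_def rot_rot rot_in_level)
  then show "restrict (rot (x \<otimes>\<^bsub>roots_of_unity_group d\<^esub> y)) (level n) =
      restrict (rot x) (level n) \<otimes>\<^bsub>BijGroup (level n)\<^esub> restrict (rot y) (level n)"
    using xy rot_Bij[OF assms] by (simp add: BijGroup_def roots_of_unity_group_def)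
qed (use rot_Bij[OF assms] in \<open>auto simp: BijGroup_def roots_of_unity_group_def\<close>)

lemma roots_of_unity_orbits:
  assumes "n \<ge> 1"
  shows "orbits (roots_of_unity_group d) (level n) (\<lambda>\<zeta>. restrict (rot \<zeta>) (level n)) =
    {{\<beta> \<in> level n. \<phi> \<beta> = \<delta>} | \<delta>. \<delta> \<in> level (n - 1)}"
proof -
  have orb: "orbit (roots_of_unity_group d) (\<lambda>\<zeta>. restrict (rot \<zeta>) (level n)) x
      = {\<beta> \<in> level n. \<phi> \<beta> = \<phi> x}" if "x \<in> level n" for x
    using that assms ex_rot[of _ x]
    by (auto simp: orbit_def roots_of_unity_group_def rot_in_level \<phi>_rot)
  obtain m where n: "n = Suc m" using assms by (cases n) auto
  have "orbits (roots_of_unity_group d) (level n) (\<lambda>\<zeta>. restrict (rot \<zeta>) (level n))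
      = (\<lambda>\<delta>. {\<beta> \<in> level n. \<phi> \<beta> = \<delta>}) ` \<phi> ` level n"
    unfolding orbits_def Setcompr_eq_image image_image Collect_mem_eq
    by (rule image_cong[OF refl orb])
  also have "\<phi> ` level n = level (n - 1)"
    using surj_\<phi> by (auto simp: n level_Suc image_iff) (metis level_Suc surjD)
  finally show ?thesis unfolding Setcompr_eq_image Collect_mem_eq .
qed

subsection \<open>Galois equivariance\<close>

lemma \<phi>_points_over: "is_subfield L \<Longrightarrow> F \<subseteq> L \<Longrightarrow> x \<in> points_over L \<Longrightarrow> \<phi> x \<in> points_over L"
  unfolding \<phi>_def using coeffs_\<phi> by (intro rat_map_in_points_over) auto

lemma \<mu>_points_over: "is_subfield L \<Longrightarrow> F \<subseteq> L \<Longrightarrow> x \<in> points_over L \<Longrightarrow> \<mu> x \<in> points_over L"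
  unfolding \<mu>_def using coeffs_\<mu> by (intro rat_map_in_points_over) auto

lemma F_subset_Kn: "F \<subseteq> Kn n" by (rule adjoin_superset)

text \<open>A point of level \<open>n\<close> is the image under \<open>\<phi>\<close>, which is defined over \<open>F\<close>, of a point of the next
  level.\<close>

lemma Kn_subset_Suc: "Kn n \<subseteq> Kn (Suc n)"
proof (rule adjoin_least[OF is_subfield_adjoin F_subset_Kn])
  fix x assume "Aff x \<in> level n"
  moreover obtain y where y: "\<phi> y = Aff x" using surj_\<phi> by (metis surjD)
  ultimately have "y \<in> level (Suc n)" by (simp add: level_Suc)
  then have "\<phi> y \<in> points_over (Kn (Suc n))"
    by (intro \<phi>_points_over is_subfield_adjoin F_subset_Kn in_points_over_adjoin)
  then show "x \<in> Kn (Suc n)" by (simp add: y)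
qed

lemma Kn_mono: "m \<le> n \<Longrightarrow> Kn m \<subseteq> Kn n"
  using lift_Suc_mono_le[of Kn] Kn_subset_Suc by blast

lemma level_over_Kn: "x \<in> level m \<Longrightarrow> m \<le> n \<Longrightarrow> x \<in> points_over (Kn n)"
  using in_points_over_adjoin points_over_mono[OF Kn_mono] by blast

text \<open>A root of unity is the ratio of the \<open>\<mu>\<close>-coordinates of two points over \<open>\<alpha>\<close>.\<close>

lemma roots_of_unity_in_K1: "{\<zeta>. \<zeta> ^ d = 1} \<subseteq> Kn 1"
proof safe
  fix \<zeta> :: 'a assume \<zeta>: "\<zeta> ^ d = 1"
  obtain x where "\<phi> x = Aff \<alpha>" using surj_\<phi> by (metis surjD)
  then have x: "x \<in> level 1" using level_Suc[of x 0] by (simp add: level_0)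
  have "\<mu> x \<notin> {Aff 0, Infty}" using unramified[of 1 x] x by (simp add: preimages_def)
  then obtain a where a: "\<mu> x = Aff a" "a \<noteq> 0" by (cases "\<mu> x") auto
  have in_K1: "\<mu> y \<in> points_over (Kn 1)" if "y \<in> level 1" for y
    using that by (intro \<mu>_points_over is_subfield_adjoin F_subset_Kn in_points_over_adjoin)
  have "a \<in> Kn 1" "\<zeta> * a \<in> Kn 1"
    using in_K1[OF x] in_K1[OF rot_in_level[OF _ \<zeta> x]] by (simp_all add: \<mu>_rot a)
  then have "\<zeta> * a / a \<in> Kn 1" by (intro is_subfield_closed(7) is_subfield_adjoin)
  then show "\<zeta> \<in> Kn 1" using a(2) by simp
qed

lemma is_subfield_Kinf: "is_subfield Kinf"
  by (rule is_subfield_Union_chain) (auto intro: is_subfield_adjoin subsetD[OF Kn_subset_Suc])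

end

locale preimage_tree_automorphism = preimage_tree P Q M N \<phi> \<mu> \<nu> d F \<alpha> \<omega>
    + field_automorphism L F \<sigma>
  for P Q M N :: "'a::alg_closed_field poly" and \<phi> \<mu> \<nu> d F \<alpha> \<omega> L \<sigma>
begin

lemma \<phi>_map: "x \<in> points_over L \<Longrightarrow> \<phi> (map_P1 \<sigma> x) = map_P1 \<sigma> (\<phi> x)"
  unfolding \<phi>_def using coeffs_\<phi> by (intro rat_map_commute[symmetric]) auto

lemma \<mu>_map: "x \<in> points_over L \<Longrightarrow> \<mu> (map_P1 \<sigma> x) = map_P1 \<sigma> (\<mu> x)"
  unfolding \<mu>_def using coeffs_\<mu> by (intro rat_map_commute[symmetric]) auto

lemma map_in_level: "x \<in> points_over L \<Longrightarrow> x \<in> level n \<Longrightarrow> map_P1 \<sigma> x \<in> level n"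
proof (induction n arbitrary: x)
  case 0
  then show ?case using \<alpha>_in_F by (auto simp: level_0 fixed)
next
  case (Suc n)
  then show ?case by (simp add: level_Suc \<phi>_map \<phi>_points_over subfield_L subset)
qed

text \<open>The automorphism is semilinear for multiplication in the coordinate \<open>\<mu>\<close>, so it commutes with the
  action of those roots of unity that it fixes.\<close>

lemma map_rot:
  assumes "\<zeta> \<in> L" "x \<in> points_over L" "rot \<zeta> x \<in> points_over L"
  shows "map_P1 \<sigma> (rot \<zeta> x) = rot (\<sigma> \<zeta>) (map_P1 \<sigma> x)"
  unfolding \<mu>_eq_iff[symmetric, of "map_P1 \<sigma> (rot \<zeta> x)"] \<mu>_rot
  using assms by (simp add: \<mu>_map \<mu>_rot map_P1_scale \<mu>_points_over subfield_L subset)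

end

context preimage_tree begin

subsection \<open>Labeling the tree\<close>

text \<open>Serves as the base point of the fiber over \<open>\<delta>\<close>, relative to which rotations are measured.\<close>

definition lift :: "'a P1 \<Rightarrow> 'a P1" where "lift = inv_into UNIV \<phi>"

text \<open>The last letter \<open>x\<close> of a word says that its node is the rotation by \<open>\<omega> ^ x\<close> of the base
  point over the node of the preceding letters.\<close>

definition node :: "nat list \<Rightarrow> 'a P1" where
  "node w = foldl (\<lambda>\<delta> x. rot (\<omega> ^ x) (lift \<delta>)) (Aff \<alpha>) w"

lemma \<phi>_lift [simp]: "\<phi> (lift \<delta>) = \<delta>"
  unfolding lift_def by (rule surj_f_inv_f[OF surj_\<phi>])

lemma lift_in_level: "\<delta> \<in> level n \<Longrightarrow> lift \<delta> \<in> level (Suc n)"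
  by (simp add: level_Suc)

lemma node_Nil [simp]: "node [] = Aff \<alpha>"
  by (simp add: node_def)

lemma node_snoc: "node (w @ [x]) = rot (\<omega> ^ x) (lift (node w))"
  by (simp add: node_def)

lemma \<phi>_node_snoc [simp]: "\<phi> (node (w @ [x])) = node w"
  by (simp add: node_snoc \<phi>_rot \<omega>_root)

lemma node_in_level: "node w \<in> level (length w)"
  by (induction w rule: rev_induct) (simp_all add: level_0 level_Suc)

lemma rot_power_eq_iff:
  assumes "x \<in> level n" "n \<ge> 1"
  shows "rot (\<omega> ^ i) x = rot (\<omega> ^ j) x \<longleftrightarrow> i mod d = j mod d"
  by (simp add: rot_eq_iff[OF assms] primitive_root_power_eq_iff[OF \<omega> d_pos])

lemma node_snoc_eq_iff:
  assumes "x < d" "y < d"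
  shows "node (w @ [x]) = node (w @ [y]) \<longleftrightarrow> x = y"
  using rot_power_eq_iff[OF lift_in_level[OF node_in_level]] assms by (simp add: node_snoc)

lemma node_inj:
  assumes "v \<in> lists {..<d}" "w \<in> lists {..<d}" "length v = length w" "node v = node w"
  shows "v = w"
  using assms
proof (induction v arbitrary: w rule: rev_induct)
  case (snoc x v)
  then obtain w' y where w: "w = w' @ [y]" by (cases w rule: rev_cases) auto
  have "node v = node w'"
    using arg_cong[OF snoc.prems(4), of \<phi>] by (simp add: w)
  then have "v = w'" using snoc by (simp add: w)
  with snoc.prems show ?case by (simp add: w node_snoc_eq_iff)
qed simp

lemma ex_node:
  assumes "\<beta> \<in> level n"
  shows "\<exists>w\<in>lists {..<d}. length w = n \<and> node w = \<beta>"
  using assms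
proof (induction n arbitrary: \<beta>)
  case 0
  then show ?case by (auto simp: level_0)
next
  case (Suc n)
  then obtain w where w: "w \<in> lists {..<d}" "length w = n" "node w = \<phi> \<beta>"
    by (auto simp: level_Suc)
  obtain k where "k < d" "\<beta> = rot (\<omega> ^ k) (lift (\<phi> \<beta>))"
    using ex_rot_power[of \<beta> "lift (\<phi> \<beta>)"] by auto
  with w show ?case by (intro bexI[of _ "w @ [k]"]) (auto simp: node_snoc)
qed

lemma bij_betw_node:
  "bij_betw node {w \<in> lists {..<d}. length w = n} (level n)"
proof (rule bij_betwI')
  show "\<And>x y. x \<in> {w \<in> lists {..<d}. length w = n} \<Longrightarrow> y \<in> {w \<in> lists {..<d}. length w = n} \<Longrightarrow>
      (node x = node y) = (x = y)" by (auto intro: node_inj)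
  show "\<exists>w\<in>{w \<in> lists {..<d}. length w = n}. \<beta> = node w" if "\<beta> \<in> level n" for \<beta>
    using ex_node[OF that] by auto
qed (use node_in_level in auto)

lemma finite_level: "finite (level n)" and card_level: "card (level n) = d ^ n"
proof -
  have eq: "{w \<in> lists {..<d}. length w = n} = {w. set w \<subseteq> {..<d} \<and> length w = n}" by auto
  have "finite {w \<in> lists {..<d}. length w = n}" unfolding eq by (rule finite_lists_length_eq) simp
  then show "finite (level n)" using bij_betw_finite[OF bij_betw_node] by blast
  show "card (level n) = d ^ n"
    using bij_betw_same_card[OF bij_betw_node, of n] unfolding eq
    by (simp add: card_lists_length_eq)
qed

definition label :: "nat list \<Rightarrow> nat \<times> 'a P1" where
  "label w = (length w, node w)"

lemma inj_on_label: "inj_on label (word_verts d)"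
  by (rule inj_onI) (auto simp: label_def word_verts_def intro: node_inj)

lemma label_image: "label ` word_verts d = preim_verts \<phi> (Aff \<alpha>)"
proof
  show "label ` word_verts d \<subseteq> preim_verts \<phi> (Aff \<alpha>)"
    by (auto simp: label_def preim_verts_def node_in_level)
  show "preim_verts \<phi> (Aff \<alpha>) \<subseteq> label ` word_verts d"
    using ex_node by (force simp: label_def preim_verts_def word_verts_def image_iff)
qed

text \<open>Reads off adjacency of words from their nodes, where automorphisms act.\<close>

lemma word_edge_iff:
  assumes "u \<in> word_verts d" "v \<in> word_verts d"
  shows "(u, v) \<in> word_edges d \<longleftrightarrow> length v = Suc (length u) \<and> \<phi> (node v) = node u"
proof
  assume "(u, v) \<in> word_edges d"
  then show "length v = Suc (length u) \<and> \<phi> (node v) = node u" by (auto simp: word_edges_def)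
next
  assume *: "length v = Suc (length u) \<and> \<phi> (node v) = node u"
  then obtain v' x where v: "v = v' @ [x]" by (cases v rule: rev_cases) auto
  then have "v' = u" using * assms by (intro node_inj) (auto simp: word_verts_def)
  with v assms show "(u, v) \<in> word_edges d" by (auto simp: word_edges_def word_verts_def)
qed

lemma labeling_label: "labeling d \<phi> (Aff \<alpha>) label"
  unfolding labeling_def rooted_tree_iso_def
proof (intro conjI ballI)
  show "bij_betw label (word_verts d) (preim_verts \<phi> (Aff \<alpha>))"
    using inj_on_label label_image by (simp add: bij_betw_def)
  show "label [] = (0, Aff \<alpha>)" by (simp add: label_def)
  fix u v assume uv: "u \<in> word_verts d" "v \<in> word_verts d"
  show "(u, v) \<in> word_edges d \<longleftrightarrow> (label u, label v) \<in> preim_edges \<phi> (Aff \<alpha>)"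
    using node_in_level[of v]
    by (auto simp: word_edge_iff[OF uv] label_def preim_edges_def)
qed

end

context preimage_tree_automorphism begin

lemma map_fiber:
  assumes "x \<in> level n" "points_over L \<supseteq> level n"
  shows "\<phi> (map_P1 \<sigma> x) = map_P1 \<sigma> (\<phi> x)"
  using assms by (intro \<phi>_map) auto

lemma map_rot_power:
  assumes "n \<ge> 1" "x \<in> level n" "level n \<subseteq> points_over L" "\<omega> \<in> L" "\<sigma> \<omega> = \<omega>"
  shows "map_P1 \<sigma> (rot (\<omega> ^ k) x) = rot (\<omega> ^ k) (map_P1 \<sigma> x)"
proof -
  have "\<omega> ^ k \<in> L \<and> \<sigma> (\<omega> ^ k) = \<omega> ^ k"
    by (induction k) (auto simp: L_closed one mult assms(4,5))
  moreover have "rot (\<omega> ^ k) x \<in> level n" by (rule rot_in_level[OF assms(1) \<omega>_root assms(2)])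
  ultimately show ?thesis using assms(2,3) by (subst map_rot) auto
qed

end

context preimage_tree begin

subsection \<open>The kernel of restriction\<close>

text \<open>The amount, relative to the base point, by which \<open>\<sigma>\<close> rotates the fiber over \<open>\<delta>\<close>. It is meant for
  automorphisms that map this fiber to itself.\<close>

definition twist :: "('a \<Rightarrow> 'a) \<Rightarrow> 'a P1 \<Rightarrow> nat" where
  "twist \<sigma> \<delta> = (THE k. k < d \<and> map_P1 \<sigma> (lift \<delta>) = rot (\<omega> ^ k) (lift \<delta>))"

lemma twist_unique:
  assumes "\<delta> \<in> level n" "map_P1 \<sigma> (lift \<delta>) = rot (\<omega> ^ k) (lift \<delta>)"
  shows "twist \<sigma> \<delta> = k mod d"
  unfolding twist_def
proof (rule the_equality)
  note lift = lift_in_level[OF assms(1)]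
  show "k mod d < d \<and> map_P1 \<sigma> (lift \<delta>) = rot (\<omega> ^ (k mod d)) (lift \<delta>)"
    using d_pos rot_power_eq_iff[OF lift, of "k mod d" k] assms(2) by simp
  show "j = k mod d" if "j < d \<and> map_P1 \<sigma> (lift \<delta>) = rot (\<omega> ^ j) (lift \<delta>)" for j
    using that rot_power_eq_iff[OF lift, of j k] assms(2) by simp
qed

lemma Gal_eqI:
  assumes "\<sigma> \<in> carrier (Gal L F)" "\<tau> \<in> carrier (Gal L F)" "\<And>x. x \<in> L \<Longrightarrow> \<sigma> x = \<tau> x"
  shows "\<sigma> = \<tau>"
proof (rule extensionalityI)
  show "\<sigma> \<in> extensional L" "\<tau> \<in> extensional L"
    using assms(1,2) by (auto simp: Gal_def Bij_def)
qed (use assms(3) in auto)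

text \<open>An automorphism over \<open>K\<^sub>n\<^sub>-\<^sub>1\<close> fixes level \<open>n - 1\<close> and, as \<open>n \<ge> 2\<close>, the roots of unity. So it rotates
  each fiber over level \<open>n - 1\<close> by a constant amount. The amounts add up under composition because
  rotations commute with automorphisms, and if all of them are known, then the action on level \<open>n\<close>
  is known, hence the automorphism of \<open>K\<^sub>n\<close>.\<close>

lemma restriction_kernel_embeds:
  assumes n: "n \<ge> 2"
  shows "\<exists>h. h \<in> mon (restriction_kernel (Kn n) (Kn (n - 1)) F)
      (product_group {..<d ^ (n - 1)} (\<lambda>_. integer_mod_group d))"
proof -
  define m where "m = n - 1"
  have m: "m \<ge> 1" "n = Suc m" using n by (auto simp: m_def)
  let ?L = "Kn n" and ?G = "restriction_kernel (Kn n) (Kn m) F" and ?I = "{..<d ^ m}"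
  have F_L: "is_subfield ?L" "F \<subseteq> ?L" by (auto intro: is_subfield_adjoin subsetD[OF F_subset_Kn])
  have over: "level j \<subseteq> points_over ?L" if "j \<le> n" for j using level_over_Kn that by blast
  have G: "\<sigma> \<in> carrier (Gal ?L F) \<and> (\<forall>x\<in>Kn m. \<sigma> x = x)" if "\<sigma> \<in> carrier ?G" for \<sigma>
  proof -
    have "restrict \<sigma> (Kn m) = (\<lambda>x\<in>Kn m. x)" "\<sigma> \<in> carrier (Gal ?L F)"
      using that by (auto simp: restriction_kernel_def kernel_def Gal_def BijGroup_def)
    then show ?thesis by (metis restrict_apply')
  qed
  have G_mult: "\<sigma> \<otimes>\<^bsub>?G\<^esub> \<tau> = compose ?L \<sigma> \<tau>" if "\<sigma> \<in> carrier ?G" "\<tau> \<in> carrier ?G" for \<sigma> \<tau>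
  proof -
    have "\<sigma> \<otimes>\<^bsub>Gal ?L F\<^esub> \<tau> = compose ?L \<sigma> \<tau>" using G that by (intro Gal_mult) auto
    then show ?thesis by (simp add: restriction_kernel_def)
  qed
  have auto_loc: "preimage_tree_automorphism P Q M N \<phi> \<mu> \<nu> d F \<alpha> \<omega> ?L \<sigma>" if "\<sigma> \<in> carrier ?G" for \<sigma>
    using F_L G that
    by (intro preimage_tree_automorphism.intro preimage_tree_axioms field_automorphism.intro) auto
  have \<omega>_in: "\<omega> \<in> Kn m"
    using roots_of_unity_in_K1 Kn_mono[OF m(1)] \<omega>_root[of 1] by auto
  then have \<omega>_in_L: "\<omega> \<in> ?L" using Kn_subset_Suc m(2) by blast
  have fixes_level: "map_P1 \<sigma> \<delta> = \<delta>" if "\<sigma> \<in> carrier ?G" "\<delta> \<in> level m" for \<sigma> \<delta>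
    using G[OF that(1)] level_over_Kn[OF that(2) order_refl] by (cases \<delta>) auto
  have commute: "map_P1 \<sigma> (rot (\<omega> ^ k) x) = rot (\<omega> ^ k) (map_P1 \<sigma> x)"
    if "\<sigma> \<in> carrier ?G" "x \<in> level n" for \<sigma> x k
    using preimage_tree_automorphism.map_rot_power[OF auto_loc[OF that(1)] _ that(2) over[OF order_refl] \<omega>_in_L]
      G[OF that(1)] \<omega>_in n by auto
  have twist: "map_P1 \<sigma> (lift \<delta>) = rot (\<omega> ^ twist \<sigma> \<delta>) (lift \<delta>)" "twist \<sigma> \<delta> < d"
    if "\<sigma> \<in> carrier ?G" "\<delta> \<in> level m" for \<sigma> \<delta>
  proof -
    have lift: "lift \<delta> \<in> level n" using lift_in_level[OF that(2)] m by simp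
    have "\<phi> (map_P1 \<sigma> (lift \<delta>)) = \<phi> (lift \<delta>)"
      using preimage_tree_automorphism.map_fiber[OF auto_loc[OF that(1)] lift over[OF order_refl]]
        fixes_level[OF that] by simp
    then obtain k where k: "k < d" "map_P1 \<sigma> (lift \<delta>) = rot (\<omega> ^ k) (lift \<delta>)"
      using ex_rot_power by blast
    then show "map_P1 \<sigma> (lift \<delta>) = rot (\<omega> ^ twist \<sigma> \<delta>) (lift \<delta>)" "twist \<sigma> \<delta> < d"
      using twist_unique[OF that(2) k(2)] by auto
  qed
  obtain e where e: "bij_betw e ?I (level m)"
    using ex_bij_betw_nat_finite[OF finite_level[of m]] by (auto simp: card_level atLeast0LessThan)
  define h where "h = (\<lambda>\<sigma>. \<lambda>i\<in>?I. int (twist \<sigma> (e i)))"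
  have e_in: "e i \<in> level m" if "i \<in> ?I" for i using e that by (auto dest: bij_betw_apply)
  have "h \<in> hom ?G (product_group ?I (\<lambda>_. integer_mod_group d))"
  proof (rule homI)
    fix \<sigma> assume "\<sigma> \<in> carrier ?G"
    then show "h \<sigma> \<in> carrier (product_group ?I (\<lambda>_. integer_mod_group d))"
      using twist(2) e_in d_pos by (auto simp: h_def carrier_integer_mod_group)
  next
    fix \<sigma> \<tau> assume \<sigma>\<tau>: "\<sigma> \<in> carrier ?G" "\<tau> \<in> carrier ?G"
    have "twist (compose ?L \<sigma> \<tau>) \<delta> = (twist \<sigma> \<delta> + twist \<tau> \<delta>) mod d" if \<delta>: "\<delta> \<in> level m" for \<delta>
    proof (rule twist_unique[OF \<delta>])
      have lift: "lift \<delta> \<in> level n" using lift_in_level[OF \<delta>] m by simp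
      then have "map_P1 (compose ?L \<sigma> \<tau>) (lift \<delta>) = map_P1 \<sigma> (map_P1 \<tau> (lift \<delta>))"
        using over by (intro map_P1_compose) auto
      also have "\<dots> = rot (\<omega> ^ twist \<tau> \<delta>) (map_P1 \<sigma> (lift \<delta>))"
        by (simp add: twist(1)[OF \<sigma>\<tau>(2) \<delta>] commute[OF \<sigma>\<tau>(1) lift])
      also have "\<dots> = rot (\<omega> ^ (twist \<sigma> \<delta> + twist \<tau> \<delta>)) (lift \<delta>)"
        by (simp add: twist(1)[OF \<sigma>\<tau>(1) \<delta>] rot_rot power_add mult.commute)
      finally show "map_P1 (compose ?L \<sigma> \<tau>) (lift \<delta>)
          = rot (\<omega> ^ (twist \<sigma> \<delta> + twist \<tau> \<delta>)) (lift \<delta>)" .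
    qed
    then show "h (\<sigma> \<otimes>\<^bsub>?G\<^esub> \<tau>) = h \<sigma> \<otimes>\<^bsub>product_group ?I (\<lambda>_. integer_mod_group d)\<^esub> h \<tau>"
      unfolding G_mult[OF \<sigma>\<tau>] using e_in
      by (auto simp: h_def zmod_int)
  qed
  moreover have "inj_on h (carrier ?G)"
  proof (rule inj_onI)
    fix \<sigma> \<tau> assume \<sigma>\<tau>: "\<sigma> \<in> carrier ?G" "\<tau> \<in> carrier ?G" and eq: "h \<sigma> = h \<tau>"
    have tw: "twist \<sigma> \<delta> = twist \<tau> \<delta>" if \<delta>: "\<delta> \<in> level m" for \<delta>
    proof -
      have "\<delta> \<in> e ` ?I" using bij_betw_imp_surj_on[OF e] \<delta> by simp
      then obtain i where "i \<in> ?I" "\<delta> = e i" by blast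
      then show ?thesis using fun_cong[OF eq, of i] by (simp add: h_def)
    qed
    have "map_P1 \<sigma> x = map_P1 \<tau> x" if x: "x \<in> level n" for x
    proof -
      have \<delta>: "\<phi> x \<in> level m" using x m by (simp add: level_Suc)
      have lift: "lift (\<phi> x) \<in> level n" using lift_in_level[OF \<delta>] m by simp
      obtain k where k: "x = rot (\<omega> ^ k) (lift (\<phi> x))"
        using ex_rot_power[of x "lift (\<phi> x)"] by auto
      show ?thesis
        by (subst (1 2) k) (simp add: commute[OF \<sigma>\<tau>(1) lift] commute[OF \<sigma>\<tau>(2) lift]
            twist(1)[OF \<sigma>\<tau>(1) \<delta>] twist(1)[OF \<sigma>\<tau>(2) \<delta>] tw[OF \<delta>])
    qed
    then have "\<sigma> x = \<tau> x" if "x \<in> ?L" for x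
      using automorphisms_agree_on_adjoin[OF F_L, of \<sigma> \<tau> "level n" x] G[OF \<sigma>\<tau>(1)] G[OF \<sigma>\<tau>(2)]
        over[OF order_refl] that by blast
    then show "\<sigma> = \<tau>" using Gal_eqI G[OF \<sigma>\<tau>(1)] G[OF \<sigma>\<tau>(2)] by blast
  qed
  ultimately show ?thesis unfolding mon_def m_def by blast
qed

subsection \<open>The embedding into the iterated wreath product\<close>

lemma level_over_Kinf: "level n \<subseteq> points_over Kinf"
  using level_over_Kn[of _ n "Suc n"] points_over_mono[of "Kn (Suc n)" Kinf] by fastforce

lemma F_subset_Kinf: "F \<subseteq> Kinf"
  using F_subset_Kn[of 1] by fastforce

lemma automorphism_Kinf:
  "\<sigma> \<in> carrier (Gal Kinf F) \<Longrightarrow>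
    preimage_tree_automorphism P Q M N \<phi> \<mu> \<nu> d F \<alpha> \<omega> Kinf \<sigma>"
  by (intro preimage_tree_automorphism.intro preimage_tree_axioms field_automorphism.intro
      is_subfield_Kinf F_subset_Kinf)

lemma labeled_action_node:
  assumes \<sigma>: "\<sigma> \<in> carrier (Gal Kinf F)" and w: "w \<in> word_verts d"
  shows "labeled_action d label \<sigma> w \<in> word_verts d"
    and "length (labeled_action d label \<sigma> w) = length w"
    and "node (labeled_action d label \<sigma> w) = map_P1 \<sigma> (node w)"
proof -
  interpret \<sigma>: preimage_tree_automorphism P Q M N \<phi> \<mu> \<nu> d F \<alpha> \<omega> Kinf \<sigma>
    by (rule automorphism_Kinf[OF \<sigma>])
  have "map_P1 \<sigma> (node w) \<in> level (length w)"
    using level_over_Kinf node_in_level by (intro \<sigma>.map_in_level) auto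
  then have in_tree: "map_prod id (map_P1 \<sigma>) (label w) \<in> label ` word_verts d"
    unfolding label_image by (simp add: label_def preim_verts_def)
  have g: "labeled_action d label \<sigma> w
      = the_inv_into (word_verts d) label (map_prod id (map_P1 \<sigma>) (label w))"
    using w by (simp add: labeled_action_def)
  show "labeled_action d label \<sigma> w \<in> word_verts d"
    unfolding g by (rule the_inv_into_into[OF inj_on_label in_tree order_refl])
  have "label (labeled_action d label \<sigma> w) = map_prod id (map_P1 \<sigma>) (label w)"
    unfolding g by (rule f_the_inv_into_f[OF inj_on_label in_tree])
  then show "length (labeled_action d label \<sigma> w) = length w"
    "node (labeled_action d label \<sigma> w) = map_P1 \<sigma> (node w)"
    by (simp_all add: label_def)
qed

text \<open>Let \<open>u\<close> be the image of the word \<open>w\<close>. The automorphism sends the base point over the node of \<open>w\<close>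
  to the rotation by some \<open>\<omega> ^ k\<close> of the base point over the node of \<open>u\<close>. As it commutes with
  rotations, the child \<open>w @ [x]\<close> goes to the child of \<open>u\<close> with letter \<open>x + k\<close> modulo \<open>d\<close>.\<close>

lemma labeled_action_in_wreath:
  assumes \<sigma>: "\<sigma> \<in> carrier (Gal Kinf F)" and roots: "{\<zeta>. \<zeta> ^ d = 1} \<subseteq> F"
  shows "labeled_action d label \<sigma> \<in> Bij (word_verts d)"
    and "labeled_action d label \<sigma> \<in> carrier (wreath_cyclic d)"
proof -
  interpret \<sigma>: preimage_tree_automorphism P Q M N \<phi> \<mu> \<nu> d F \<alpha> \<omega> Kinf \<sigma>
    by (rule automorphism_Kinf[OF \<sigma>])
  let ?V = "word_verts d" and ?g = "labeled_action d label \<sigma>"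
  note g = labeled_action_node[OF \<sigma>]
  have over: "node w \<in> points_over Kinf" for w using level_over_Kinf node_in_level by blast
  have \<omega>_F: "\<omega> \<in> F" using roots \<omega>_root[of 1] by auto
  have inj: "inj_on ?g ?V"
  proof (rule inj_onI)
    fix v w assume vw: "v \<in> ?V" "w \<in> ?V" "?g v = ?g w"
    then have "length v = length w" "map_P1 \<sigma> (node v) = map_P1 \<sigma> (node w)"
      using g(2,3)[of v] g(2,3)[of w] by auto
    with vw(1,2) show "v = w"
      unfolding \<sigma>.map_P1_eq_iff[OF over over] by (intro node_inj) (auto simp: word_verts_def)
  qed
  \<comment> \<open>There are finitely many words of each length, so an injective map that preserves the length
    is onto.\<close>
  have "?V \<subseteq> ?g ` ?V"
  proof
    fix w assume w: "w \<in> ?V"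
    let ?S = "{v \<in> ?V. length v = length w}"
    have "?g ` ?S = ?S"
    proof (rule endo_inj_surj)
      have "?S = {v. set v \<subseteq> {..<d} \<and> length v = length w}" by (auto simp: word_verts_def)
      then show "finite ?S" using finite_lists_length_eq[of "{..<d}" "length w"] by simp
      show "?g ` ?S \<subseteq> ?S" using g(1,2) by auto
      show "inj_on ?g ?S" using inj by (rule inj_on_subset) auto
    qed
    moreover have "w \<in> ?S" "?S \<subseteq> ?V" using w by auto
    ultimately show "w \<in> ?g ` ?V" by blast
  qed
  then have bij: "bij_betw ?g ?V ?V" using inj g(1) by (auto simp: bij_betw_def)
  then show Bij: "?g \<in> Bij ?V" by (simp add: Bij_def labeled_action_def)
  have nil: "[] \<in> ?V" by (simp add: word_verts_def)
  have "rooted_tree_iso ?V (word_edges d) [] ?V (word_edges d) [] ?g"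
    unfolding rooted_tree_iso_def
  proof (intro conjI ballI bij)
    show "?g [] = []" using g(2)[OF nil] by simp
    fix u v assume uv: "u \<in> ?V" "v \<in> ?V"
    have "\<phi> (node (?g v)) = node (?g u) \<longleftrightarrow> map_P1 \<sigma> (\<phi> (node v)) = map_P1 \<sigma> (node u)"
      unfolding g(3)[OF uv(1)] g(3)[OF uv(2)] \<sigma>.\<phi>_map[OF over] ..
    also have "\<dots> \<longleftrightarrow> \<phi> (node v) = node u"
      by (intro \<sigma>.map_P1_eq_iff \<phi>_points_over is_subfield_Kinf F_subset_Kinf over)
    finally show "(u, v) \<in> word_edges d \<longleftrightarrow> (?g u, ?g v) \<in> word_edges d"
      by (simp add: word_edge_iff uv g)
  qed
  moreover have "\<exists>k. \<forall>x<d. local_perm ?g w x = (cycle_of_list [0..<d] ^^ k) x" if w: "w \<in> ?V" for w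
  proof -
    let ?u = "?g w"
    have lift: "lift (node w) \<in> level (Suc (length w))" "lift (node ?u) \<in> level (Suc (length ?u))"
      by (intro lift_in_level node_in_level)+
    have "\<phi> (map_P1 \<sigma> (lift (node w))) = \<phi> (lift (node ?u))"
      using \<sigma>.map_fiber[OF lift(1) level_over_Kinf] by (simp add: g(3)[OF w])
    then obtain k where k: "map_P1 \<sigma> (lift (node w)) = rot (\<omega> ^ k) (lift (node ?u))"
      using ex_rot_power by blast
    have "local_perm ?g w x = (x + k) mod d" if x: "x < d" for x
    proof -
      have wx: "w @ [x] \<in> ?V" using w x by (simp add: word_verts_def)
      obtain v y where v: "?g (w @ [x]) = v @ [y]"
        using g(2)[OF wx] by (cases "?g (w @ [x])" rule: rev_cases) auto
      have vy: "v \<in> ?V" "y < d" "length v = length w"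
        using g(1,2)[OF wx] unfolding v by (auto simp: word_verts_def)
      have node_v: "node (v @ [y]) = map_P1 \<sigma> (node (w @ [x]))"
        using g(3)[OF wx] unfolding v .
      have "node v = map_P1 \<sigma> (node w)"
        using arg_cong[OF node_v, of \<phi>] unfolding \<sigma>.\<phi>_map[OF over] by simp
      then have "v = ?u"
        using vy g[OF w] by (intro node_inj) (auto simp: word_verts_def)
      have "rot (\<omega> ^ y) (lift (node ?u)) = map_P1 \<sigma> (rot (\<omega> ^ x) (lift (node w)))"
        using node_v unfolding \<open>v = ?u\<close> node_snoc .
      also have "\<dots> = rot (\<omega> ^ x) (map_P1 \<sigma> (lift (node w)))"
        using \<omega>_F F_subset_Kinf
        by (intro \<sigma>.map_rot_power[OF _ lift(1) level_over_Kinf]) (auto simp: \<sigma>.fixed)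
      also have "\<dots> = rot (\<omega> ^ (x + k)) (lift (node ?u))"
        by (simp add: k rot_rot power_add)
      finally have "y mod d = (x + k) mod d" using rot_power_eq_iff[OF lift(2)] by simp
      then show ?thesis using vy(2) by (simp add: local_perm_def v)
    qed
    then show ?thesis using cycle_of_list_upt_funpow by auto
  qed
  ultimately show "?g \<in> carrier (wreath_cyclic d)"
    using Bij by (simp add: wreath_cyclic_def word_tree_aut_def)
qed

text \<open>Injective because an automorphism of \<open>K\<^sub>\<infinity>\<close> is determined by its action on the nodes, which generate
  \<open>K\<^sub>\<infinity>\<close>.\<close>

lemma labeled_action_mon:
  assumes roots: "{\<zeta>. \<zeta> ^ d = 1} \<subseteq> F"
  shows "labeled_action d label \<in> mon (Gal Kinf F) (wreath_cyclic d)"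
  unfolding mon_def
proof (intro CollectI conjI homI inj_onI)
  let ?V = "word_verts d" and ?g = "labeled_action d label"
  note g = labeled_action_node
  fix \<sigma> \<tau> assume \<sigma>: "\<sigma> \<in> carrier (Gal Kinf F)" and \<tau>: "\<tau> \<in> carrier (Gal Kinf F)"
  show "?g (\<sigma> \<otimes>\<^bsub>Gal Kinf F\<^esub> \<tau>) = ?g \<sigma> \<otimes>\<^bsub>wreath_cyclic d\<^esub> ?g \<tau>"
  proof -
    have "?g (compose Kinf \<sigma> \<tau>) w = compose ?V (?g \<sigma>) (?g \<tau>) w" for w
    proof (cases "w \<in> ?V")
      case True
      have "map_P1 (compose Kinf \<sigma> \<tau>) (node w) = map_P1 \<sigma> (map_P1 \<tau> (node w))"
        using level_over_Kinf node_in_level by (intro map_P1_compose) auto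
      then have "map_prod id (map_P1 (compose Kinf \<sigma> \<tau>)) (label w)
          = map_prod id (map_P1 \<sigma>) (label (?g \<tau> w))"
        by (simp add: label_def g(2,3)[OF \<tau> True])
      then show ?thesis
        using True g(1)[OF \<tau> True] by (simp add: compose_def labeled_action_def)
    qed (simp add: compose_def labeled_action_def)
    then show ?thesis
      using labeled_action_in_wreath(1)[OF \<sigma> roots] labeled_action_in_wreath(1)[OF \<tau> roots]
      unfolding Gal_mult[OF \<sigma> \<tau>]
      by (simp add: wreath_cyclic_def word_tree_aut_def BijGroup_def fun_eq_iff)
  qed
  show "\<sigma> = \<tau>" if eq: "?g \<sigma> = ?g \<tau>"
  proof (rule Gal_eqI[OF \<sigma> \<tau>])
    fix z assume "z \<in> Kinf"
    then obtain n where "z \<in> Kn n" by blast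
    moreover have "x \<in> points_over Kinf \<and> map_P1 \<sigma> x = map_P1 \<tau> x" if x: "x \<in> level n" for x
    proof -
      obtain w where "w \<in> ?V" "node w = x" using ex_node[OF x] by (auto simp: word_verts_def)
      moreover have "x \<in> points_over Kinf" using level_over_Kinf x by blast
      ultimately show ?thesis using g(3)[OF \<sigma>, of w] g(3)[OF \<tau>, of w] eq by simp
    qed
    ultimately show "\<sigma> z = \<tau> z"
      using automorphisms_agree_on_adjoin[OF is_subfield_Kinf F_subset_Kinf \<sigma> \<tau>] by blast
  qed
qed (use labeled_action_in_wreath(2)[OF _ roots] in auto)

end

section \<open>The preimage tree of a bicritical map\<close>

lemma ex_mobius_to_0_Infty:
  fixes \<gamma>1 \<gamma>2 :: "'a::field P1"
  assumes "is_subfield F" "\<gamma>1 \<in> points_over F" "\<gamma>2 \<in> points_over F" "\<gamma>1 \<noteq> \<gamma>2"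
  shows "\<exists>\<mu>\<in>mobius_maps F. \<mu> ` {\<gamma>1, \<gamma>2} = {Aff 0, Infty}"
proof -
  let ?a = "hom_y \<gamma>1" and ?b = "- hom_x \<gamma>1" and ?c = "hom_y \<gamma>2" and ?d = "- hom_x \<gamma>2"
  have in_F: "hom_x \<gamma> \<in> F" "hom_y \<gamma> \<in> F" if "\<gamma> \<in> points_over F" for \<gamma>
    using that by (cases \<gamma>; simp add: is_subfield_closed[OF assms(1)])+
  have det: "?a * ?d - ?b * ?c \<noteq> 0"
  proof
    assume "?a * ?d - ?b * ?c = 0"
    then have "hom_x \<gamma>1 * hom_y \<gamma>2 = hom_x \<gamma>2 * hom_y \<gamma>1" by (simp add: algebra_simps)
    then have "of_hom (hom_x \<gamma>1) (hom_y \<gamma>1) = of_hom (hom_x \<gamma>2) (hom_y \<gamma>2)"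
      unfolding of_hom_eq_iff[OF hom_coords_nonzero hom_coords_nonzero] .
    with assms(4) show False by simp
  qed
  let ?\<mu> = "rat_map [:?b, ?a:] [:?d, ?c:]"
  have "?\<mu> \<in> mobius_maps F"
    unfolding mobius_maps_def using det assms(2,3) in_F is_subfield_closed(3)[OF assms(1)] by blast
  moreover have "?\<mu> \<gamma>1 = Aff 0"
    unfolding mobius_eq_of_hom[OF det] of_hom_eq_0_iff using det by (auto simp: algebra_simps)
  moreover have "?\<mu> \<gamma>2 = Infty"
    unfolding mobius_eq_of_hom[OF det] of_hom_eq_Infty_iff by simp
  ultimately show ?thesis by auto
qed

lemma coeff_pCons_linear_mem:
  assumes "0 \<in> F" "a \<in> F" "b \<in> F"
  shows "Polynomial.coeff [:b, a:] i \<in> F"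
  using assms by (auto simp: coeff_pCons split: nat.splits)

context bicritical_rational_map begin

text \<open>A point above the root with \<open>\<mu>\<close>-coordinate \<open>0\<close> or \<open>\<infinity>\<close> would be a critical point in the backward
  orbit of \<open>\<alpha>\<close>.\<close>

lemma preimage_treeI:
  fixes F :: "'a set"
  assumes F: "is_subfield F" "\<alpha> \<in> F"
    and coeffs: "\<And>i. Polynomial.coeff P i \<in> F" "\<And>i. Polynomial.coeff Q i \<in> F"
    and \<mu>: "\<mu> \<in> mobius_maps F" "\<mu> ` {\<gamma>1, \<gamma>2} = {Aff 0, Infty}"
    and not_post_critical: "\<not> (\<exists>\<gamma>\<in>{\<gamma>1, \<gamma>2}. \<exists>n\<ge>1. (rat_map P Q ^^ n) \<gamma> = Aff \<alpha>)"
  shows "\<exists>M N \<nu> \<omega>. preimage_tree P Q M N (rat_map P Q) \<mu> \<nu> d F \<alpha> \<omega>"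
proof -
  obtain a b c e where abce: "\<mu> = rat_map [:b, a:] [:e, c:]" "a * e - b * c \<noteq> 0"
    "a \<in> F" "b \<in> F" "c \<in> F" "e \<in> F"
    using \<mu>(1) unfolding mobius_maps_def by blast
  obtain \<nu> where \<nu>: "bij \<nu>" "\<And>x. \<nu> (rat_map P Q x) = map_P1 (\<lambda>z. z ^ d) (\<mu> x)"
    using power_map_normal_form[OF \<mu>] by blast
  obtain \<omega> :: 'a where \<omega>: "primitive_root_of_unity d \<omega>"
    using ex_primitive_root_of_unity[of d] of_nat_nonzero[of d] d_ge_2 by auto
  have bij: "bij \<mu>" unfolding abce(1) by (rule bij_mobius[OF abce(2)])
  have "\<mu> x \<notin> {Aff 0, Infty}" if "n \<ge> 1" "(rat_map P Q ^^ n) x = Aff \<alpha>" for n x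
  proof
    assume "\<mu> x \<in> {Aff 0, Infty}"
    then have "\<mu> x \<in> \<mu> ` {\<gamma>1, \<gamma>2}" using \<mu>(2) by simp
    then have "x \<in> {\<gamma>1, \<gamma>2}" using inj_image_mem_iff[OF bij_is_inj[OF bij]] by blast
    with that not_post_critical show False by blast
  qed
  then have "preimage_tree P Q [:b, a:] [:e, c:] (rat_map P Q) \<mu> \<nu> d F \<alpha> \<omega>"
    using F coeffs abce(1,3-6) \<nu> \<omega> bij d_ge_2 is_subfield_closed(1)[OF F(1)]
    by (intro preimage_tree.intro) (auto intro!: coeff_pCons_linear_mem)
  then show ?thesis by blast
qed

end

theorem corollary3p5:
  fixes p q :: "'k::field poly"
    and \<phi> :: "'k alg_closure P1 \<Rightarrow> 'k alg_closure P1"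
    and \<gamma>1 \<gamma>2 :: "'k alg_closure P1"
    and \<alpha> :: "'k alg_closure"
    and d :: nat
    and K0 Kinf :: "'k alg_closure set"
    and Kn :: "nat \<Rightarrow> 'k alg_closure set"
  assumes "q \<noteq> 0"
    and "\<nexists>x :: 'k alg_closure. poly (map_poly to_ac p) x = 0 \<and> poly (map_poly to_ac q) x = 0"
    and "\<phi> = rat_map (map_poly to_ac p) (map_poly to_ac q)"
    and "rat_degree p q = d" and "d \<ge> 2"
    and "bicritical (map_poly to_ac p :: 'k alg_closure poly) (map_poly to_ac q)"
    and "critical_points (map_poly to_ac p) (map_poly to_ac q) = {\<gamma>1, \<gamma>2}"
    and "CHAR('k) = 0 \<or> CHAR('k) > d"
    and "K0 = adjoin (range to_ac) {\<gamma>1, \<gamma>2}"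
    and "\<alpha> \<in> K0"
    and "\<not> (\<exists>\<gamma>\<in>{\<gamma>1, \<gamma>2}. \<exists>n\<ge>1. (\<phi> ^^ n) \<gamma> = Aff \<alpha>)"
    and "\<forall>n. Kn n = adjoin K0 (preimages \<phi> n (Aff \<alpha>))"
    and "Kinf = (\<Union>n\<in>{1..}. Kn n)"
  shows "({\<zeta>. \<zeta> ^ d = 1} \<subseteq> Kn 1) \<and>
    (\<exists>\<mu>\<in>mobius_maps K0. \<mu> ` {\<gamma>1, \<gamma>2} = {Aff 0, Infty}) \<and>
    (\<forall>\<mu>\<in>mobius_maps K0. \<mu> ` {\<gamma>1, \<gamma>2} = {Aff 0, Infty} \<longrightarrow>
      (\<forall>n\<ge>1.
         group_action (roots_of_unity_group d) (preimages \<phi> n (Aff \<alpha>))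
           (\<lambda>\<zeta>. restrict (mult_via \<mu> \<zeta>) (preimages \<phi> n (Aff \<alpha>))) \<and>
         orbits (roots_of_unity_group d) (preimages \<phi> n (Aff \<alpha>))
           (\<lambda>\<zeta>. restrict (mult_via \<mu> \<zeta>) (preimages \<phi> n (Aff \<alpha>))) =
         {{\<beta> \<in> preimages \<phi> n (Aff \<alpha>). \<phi> \<beta> = \<delta>} | \<delta>. \<delta> \<in> preimages \<phi> (n - 1) (Aff \<alpha>)})) \<and>
    (\<forall>n\<ge>2. \<exists>h. h \<in> mon (restriction_kernel (Kn n) (Kn (n - 1)) K0)
                           (product_group {..<d ^ (n - 1)} (\<lambda>_. integer_mod_group d))) \<and>
    ({\<zeta>. \<zeta> ^ d = 1} \<subseteq> K0 \<longrightarrow>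
      (\<exists>\<Lambda>. labeling d \<phi> (Aff \<alpha>) \<Lambda> \<and> labeled_action d \<Lambda> \<in> mon (Gal Kinf K0) (wreath_cyclic d)))"
proof -
  let ?P = "map_poly to_ac p :: 'k alg_closure poly" and ?Q = "map_poly to_ac q :: 'k alg_closure poly"
  note \<phi> = assms(3)
  have deg: "rat_degree ?P ?Q = d"
    using assms(4) by (simp add: rat_degree_def degree_map_poly)
  have distinct: "\<gamma>1 \<noteq> \<gamma>2"
    using assms(6,7) by (auto simp: bicritical_def)
  have of_nat_nz: "of_nat n \<noteq> (0 :: 'k alg_closure)" if "0 < n" "n \<le> d" for n
    using assms(8) that by (auto simp: of_nat_eq_0_iff_char_dvd dest: dvd_imp_le)
  interpret bicritical_rational_map ?P ?Q d \<gamma>1 \<gamma>2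
    by (rule bicritical_rational_map.intro) (use assms deg distinct of_nat_nz in auto)
  have K0: "is_subfield K0" "range to_ac \<subseteq> K0"
    unfolding assms(9) by (rule is_subfield_adjoin, rule adjoin_superset)
  have \<gamma>: "\<gamma>1 \<in> points_over K0" "\<gamma>2 \<in> points_over K0"
    unfolding assms(9) by (rule in_points_over_adjoin, simp)+
  have coeffs: "Polynomial.coeff ?P i \<in> K0" "Polynomial.coeff ?Q i \<in> K0" for i
    using K0(2) by (auto simp: coeff_map_poly)
  have tree: "\<exists>M N \<nu> \<omega>. preimage_tree ?P ?Q M N \<phi> \<mu> \<nu> d K0 \<alpha> \<omega>"
    if "\<mu> \<in> mobius_maps K0" "\<mu> ` {\<gamma>1, \<gamma>2} = {Aff 0, Infty}" for \<mu>
    unfolding \<phi> using preimage_treeI[OF K0(1) assms(10) coeffs that] assms(11) unfolding \<phi> by blast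
  obtain \<mu> where \<mu>: "\<mu> \<in> mobius_maps K0" "\<mu> ` {\<gamma>1, \<gamma>2} = {Aff 0, Infty}"
    using ex_mobius_to_0_Infty[OF K0(1) \<gamma> distinct] by blast
  then obtain M N \<nu> \<omega> where "preimage_tree ?P ?Q M N \<phi> \<mu> \<nu> d K0 \<alpha> \<omega>"
    using tree by blast
  then interpret T: preimage_tree ?P ?Q M N \<phi> \<mu> \<nu> d K0 \<alpha> \<omega> .
  have Kn: "Kn n = T.Kn n" for n using assms(12) by blast
  have Kinf: "Kinf = T.Kinf" unfolding assms(13) Kn ..
  show ?thesis
  proof (intro conjI allI impI ballI)
    show "{\<zeta>. \<zeta> ^ d = 1} \<subseteq> Kn 1" unfolding Kn by (rule T.roots_of_unity_in_K1)
    show "\<exists>\<mu>\<in>mobius_maps K0. \<mu> ` {\<gamma>1, \<gamma>2} = {Aff 0, Infty}" using \<mu> by blast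
  next
    fix \<mu>' and n :: nat
    assume \<mu>': "\<mu>' \<in> mobius_maps K0" "\<mu>' ` {\<gamma>1, \<gamma>2} = {Aff 0, Infty}" and n: "1 \<le> n"
    obtain M' N' \<nu>' \<omega>' where "preimage_tree ?P ?Q M' N' \<phi> \<mu>' \<nu>' d K0 \<alpha> \<omega>'"
      using tree[OF \<mu>'] by blast
    then interpret T': preimage_tree ?P ?Q M' N' \<phi> \<mu>' \<nu>' d K0 \<alpha> \<omega>' .
    show "group_action (roots_of_unity_group d) (preimages \<phi> n (Aff \<alpha>))
        (\<lambda>\<zeta>. restrict (mult_via \<mu>' \<zeta>) (preimages \<phi> n (Aff \<alpha>)))"
      by (rule T'.roots_of_unity_action[OF n])
    show "orbits (roots_of_unity_group d) (preimages \<phi> n (Aff \<alpha>))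
        (\<lambda>\<zeta>. restrict (mult_via \<mu>' \<zeta>) (preimages \<phi> n (Aff \<alpha>))) =
      {{\<beta> \<in> preimages \<phi> n (Aff \<alpha>). \<phi> \<beta> = \<delta>} | \<delta>. \<delta> \<in> preimages \<phi> (n - 1) (Aff \<alpha>)}"
      by (rule T'.roots_of_unity_orbits[OF n])
  next
    fix n :: nat assume "2 \<le> n"
    then show "\<exists>h. h \<in> mon (restriction_kernel (Kn n) (Kn (n - 1)) K0)
        (product_group {..<d ^ (n - 1)} (\<lambda>_. integer_mod_group d))"
      unfolding Kn by (rule T.restriction_kernel_embeds)
  next
    assume "{\<zeta> :: 'k alg_closure. \<zeta> ^ d = 1} \<subseteq> K0"
    then show "\<exists>\<Lambda>. labeling d \<phi> (Aff \<alpha>) \<Lambda> \<and> labeled_action d \<Lambda> \<in> mon (Gal Kinf K0) (wreath_cyclic d)"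
      unfolding Kinf using T.labeling_label T.labeled_action_mon by blast
  qed
qed

end
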